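(* If $n \geq 3$, then $\mathcal W^*_n$ does not contain any extreme lattices. If $n = 2$, the hexagonal lattice is (up to similarity) the unique extreme lattice, and it is contained in $\mathcal W^*_2$. On the other hand, for every $n \geq 2$, $\mathcal W^*_n$ contains a unique minimum of the packing density function $\delta$ on the set of well-rounded lattices (up to similarity), namely the integer lattice $\mathbb Z^n$.
   Context: A lattice $L$ means a lattice of rank $n\ge 2$ in $\mathbb R^n$. $\|\cdot\|$ is the Euclidean norm, $|L| = \min\{\|x\| : x\in L\setminus\{0\}\}$, and $S(L)=\{x\in L:\|x\|=|L|\}$ is the set of minimal vectors. The packing density is $\delta(L)=\frac{\omega_n|L|^n}{2^n\det L}$, where $\omega_n$ is the volume of the unit ball in $\mathbb R^n$ and $\det L$ is the absolute value of the determinant of a basis matrix of $L$; it is a continuous function on the space of lattices $\mathrm{GL}_n(\mathbb R)/\mathrm{GL}_n(\mathbb Z)$. A lattice is extreme if it is a local maximum of $\delta$ on this space. Two lattices $L_1,L_2$ are similar if $L_2=\alpha U L_1$ for some $\alpha>0$ and some real orthogonal $n\times n$ matrix $U$; $\delta$ is constant on similarity classes. The space of similarity classes carries the quotient topology from $\mathrm{GL}_n(\mathbb R)\subset\mathbb R^{n^2}$. $L$ is well-rounded (WR) if $\mathrm{span}_{\mathbb R}S(L)=\mathrm{span}_{\mathbb R}L$. For an ordered basis $\{b_1,\dots,b_n\}$ of $L$, let $\theta_i\in(0,\pi/2]$ ($1\le i\le n-1$) be the angle between $b_{i+1}$ and the subspace $\mathrm{span}_{\mathbb R}\{b_1,\dots,b_i\}$.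 The ordered basis is weakly nearly orthogonal if $\theta_i\ge\pi/3$ for all $1\le i\le n-1$; a basis is nearly orthogonal if every ordering of it is weakly nearly orthogonal. $\mathcal W^*_n$ is the set of similarity classes of WR lattices in $\mathbb R^n$ that have a nearly orthogonal basis. The hexagonal lattice is $\begin{pmatrix}1&1/2\\0&\sqrt3/2\end{pmatrix}\mathbb Z^2$. *)

theory Defs
  imports "HOL-Analysis.Analysis"
begin

section \<open>Lattices of full rank and their bases\<close>

definition integer_lattice :: "(real ^ 'n::finite) set" where
  "integer_lattice = {x. \<forall>i. x $ i \<in> \<int>}"

text \<open>The lattice spanned over the integers by the columns of a matrix.\<close>

definition lattice_of :: "real ^ 'n ^ 'n \<Rightarrow> (real ^ 'n::finite) set" where
  "lattice_of A = (*v) A ` integer_lattice"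

definition basis_matrix :: "real ^ 'n ^ 'n \<Rightarrow> (real ^ 'n::finite) set \<Rightarrow> bool" where
  "basis_matrix A L \<longleftrightarrow> invertible A \<and> L = lattice_of A"

definition is_lattice :: "(real ^ 'n::finite) set \<Rightarrow> bool" where
  "is_lattice L \<longleftrightarrow> (\<exists>A. basis_matrix A L)"

definition lattice_basis :: "(real ^ 'n) set \<Rightarrow> (real ^ 'n::finite) set \<Rightarrow> bool" where
  "lattice_basis B L \<longleftrightarrow> (\<exists>A. basis_matrix A L \<and> B = columns A)"

text \<open>The value does not depend on the basis matrix, see \<open>lattice_det_eq\<close> below.\<close>

definition lattice_det :: "(real ^ 'n::finite) set \<Rightarrow> real" where
  "lattice_det L = (THE d. \<exists>A. basis_matrix A L \<and> d = \<bar>det A\<bar>)"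

text \<open>For a lattice the infimum is a minimum, see \<open>min_norm_attained\<close> below.\<close>

definition min_norm :: "(real ^ 'n::finite) set \<Rightarrow> real" where
  "min_norm L = (INF x \<in> L - {0}. norm x)"

definition min_vectors :: "(real ^ 'n::finite) set \<Rightarrow> (real ^ 'n) set" where
  "min_vectors L = {x \<in> L. norm x = min_norm L}"

definition packing_density :: "(real ^ 'n::finite) set \<Rightarrow> real" where
  "packing_density L =
     measure lborel (ball (0 :: real ^ 'n) 1) * min_norm L ^ CARD('n)
       / (2 ^ CARD('n) * lattice_det L)"

definition well_rounded :: "(real ^ 'n::finite) set \<Rightarrow> bool" where
  "well_rounded L \<longleftrightarrow> is_lattice L \<and> span (min_vectors L) = span L"


section \<open>The space of lattices and extreme lattices\<close>

text \<open>
  Two invertible matrices have the same image under \<^term>\<open>lattice_of\<close> iff they differ by right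
  multiplication with an element of \<open>GL\<^sub>n(\<int>)\<close>, so \<open>GL\<^sub>n(\<real>)/GL\<^sub>n(\<int>)\<close> is the set of lattices with the
  quotient topology along \<^term>\<open>lattice_of\<close>.
\<close>

definition lattice_topology :: "(real ^ 'n::finite) set topology" where
  "lattice_topology = topology (\<lambda>U. U \<subseteq> Collect is_lattice \<and>
     openin (top_of_set {A. invertible A}) {A. invertible A \<and> lattice_of A \<in> U})"

definition extreme :: "(real ^ 'n::finite) set \<Rightarrow> bool" where
  "extreme L \<longleftrightarrow> is_lattice L \<and>
     (\<exists>U. openin lattice_topology U \<and> L \<in> U \<and>
          (\<forall>M\<in>U. packing_density M \<le> packing_density L))"


section \<open>Similarity\<close>

definition similar_lattices :: "(real ^ 'n::finite) set \<Rightarrow> (real ^ 'n) set \<Rightarrow> bool" where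
  "similar_lattices L\<^sub>1 L\<^sub>2 \<longleftrightarrow>
     (\<exists>\<alpha>>0. \<exists>U. orthogonal_matrix U \<and> L\<^sub>2 = (\<lambda>x. \<alpha> *\<^sub>R (U *v x)) ` L\<^sub>1)"

definition similarity_class :: "(real ^ 'n::finite) set \<Rightarrow> (real ^ 'n) set set" where
  "similarity_class L = {M. is_lattice M \<and> similar_lattices L M}"


section \<open>Nearly orthogonal bases\<close>

text \<open>
  The angle in \<open>[0, \<pi>/2]\<close> between a nonzero vector and a nonzero subspace: the smallest angle
  between the vector and a nonzero vector of the subspace.
\<close>

definition subspace_angle :: "real ^ 'n::finite \<Rightarrow> (real ^ 'n) set \<Rightarrow> real" where
  "subspace_angle v S = (INF w \<in> S - {0}. arccos ((v \<bullet> w) / (norm v * norm w)))"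

text \<open>
  Lists are indexed from 0, so \<open>bs ! i\<close> is the vector \<open>b\<^sub>i\<^sub>+\<^sub>1\<close> and \<open>take i bs\<close> is \<open>b\<^sub>1, \<dots>, b\<^sub>i\<close>.
\<close>

definition weakly_nearly_orthogonal :: "(real ^ 'n::finite) list \<Rightarrow> bool" where
  "weakly_nearly_orthogonal bs \<longleftrightarrow>
     (\<forall>i. 1 \<le> i \<and> i < length bs \<longrightarrow> pi / 3 \<le> subspace_angle (bs ! i) (span (set (take i bs))))"

definition nearly_orthogonal :: "(real ^ 'n::finite) set \<Rightarrow> bool" where
  "nearly_orthogonal B \<longleftrightarrow>
     (\<forall>bs. distinct bs \<and> set bs = B \<longrightarrow> weakly_nearly_orthogonal bs)"

definition W_star :: "(real ^ 'n::finite) set set set" where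
  "W_star = {similarity_class L | L.
     well_rounded L \<and> (\<exists>B. lattice_basis B L \<and> nearly_orthogonal B)}"


definition hexagonal_lattice :: "(real ^ 2) set" where
  "hexagonal_lattice = lattice_of (vector [vector [1, 1 / 2], vector [0, sqrt 3 / 2]])"


section \<open>Well-definedness\<close>

lemma det_Ints:
  fixes A :: "real ^ 'n::finite ^ 'n"
  assumes "\<And>i j. A $ i $ j \<in> \<int>"
  shows "det A \<in> \<int>"
  unfolding det_def using assms by (intro Ints_sum Ints_mult Ints_prod) auto

lemma lattice_of_eq_det_le:
  fixes A B :: "real ^ 'n::finite ^ 'n"
  assumes "invertible B" and "lattice_of A = lattice_of B"
  shows "\<bar>det A\<bar> \<le> \<bar>det B\<bar>"
proof -
  have "\<exists>u. u \<in> integer_lattice \<and> column j B = A *v u" for j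
  proof -
    have "axis j 1 \<in> (integer_lattice :: (real ^ 'n) set)"
      by (auto simp: integer_lattice_def axis_def)
    then have "column j B \<in> lattice_of B"
      unfolding lattice_of_def by (metis image_eqI matrix_vector_mul_component matrix_vector_mult_basis)
    then show ?thesis
      using assms(2) by (auto simp: lattice_of_def)
  qed
  then obtain u where u: "\<And>j. u j \<in> integer_lattice" "\<And>j. column j B = A *v u j"
    by metis
  define U :: "real ^ 'n ^ 'n" where "U = (\<chi> i j. u j $ i)"
  have "B $ i $ j = (A ** U) $ i $ j" for i j
  proof -
    have "B $ i $ j = column j B $ i" by (simp add: column_def)
    also have "\<dots> = (A *v u j) $ i" by (simp add: u)
    finally show ?thesis
      by (simp add: matrix_vector_mult_def matrix_matrix_mult_def U_def)
  qed
  then have B: "B = A ** U" by (simp add: vec_eq_iff)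
  have "det U \<in> \<int>"
    using u(1) by (intro det_Ints) (auto simp: U_def integer_lattice_def)
  moreover have "det U \<noteq> 0"
    using assms(1) by (auto simp: invertible_det_nz B det_mul)
  ultimately have "1 \<le> \<bar>det U\<bar>" by (rule Ints_nonzero_abs_ge1)
  then show ?thesis
    by (simp add: B det_mul abs_mult mult_le_cancel_left1)
qed

lemma lattice_det_eq:
  assumes "basis_matrix A L"
  shows "lattice_det L = \<bar>det A\<bar>"
  unfolding lattice_det_def
proof (rule the_equality)
  show "\<exists>B. basis_matrix B L \<and> \<bar>det A\<bar> = \<bar>det B\<bar>" using assms by blast
next
  fix d assume "\<exists>B. basis_matrix B L \<and> d = \<bar>det B\<bar>"
  then show "d = \<bar>det A\<bar>"
    using assms unfolding basis_matrix_def by (metis lattice_of_eq_det_le order_antisym)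
qed

lemma min_norm_attained:
  fixes L :: "(real ^ 'n::finite) set"
  assumes "is_lattice L"
  shows "\<exists>x \<in> L - {0}. norm x = min_norm L"
    and "x \<in> L - {0} \<Longrightarrow> min_norm L \<le> norm x"
proof -
  obtain A where A: "invertible A" "L = lattice_of A"
    using assms by (auto simp: is_lattice_def basis_matrix_def)
  have inj: "inj ((*v) A)" using A(1) by (simp add: inj_matrix_vector_mult)
  have "1 \<le> norm x" if x: "x \<in> integer_lattice" "x \<noteq> 0" for x :: "real ^ 'n"
  proof -
    obtain i where "x $ i \<noteq> 0" using x(2) by (auto simp: vec_eq_iff)
    then have "1 \<le> \<bar>x $ i\<bar>"
      using x(1) by (intro Ints_nonzero_abs_ge1) (auto simp: integer_lattice_def)
    then show ?thesis using component_le_norm_cart order_trans by blast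
  qed
  then have "(integer_lattice :: (real ^ 'n) set) - {0} = integer_lattice \<inter> {x. 1 \<le> norm x}"
    by fastforce
  moreover have "closed (integer_lattice :: (real ^ 'n) set)"
  proof -
    have eq: "(integer_lattice :: (real ^ 'n) set) = (\<Inter>i. (\<lambda>x. x $ i) -` \<int>)"
      by (auto simp: integer_lattice_def)
    show ?thesis unfolding eq
      by (intro closed_INT ballI continuous_closed_vimage closed_Ints continuous_intros)
  qed
  moreover have "closed {x :: real ^ 'n. 1 \<le> norm x}"
    by (intro closed_Collect_le continuous_intros)
  ultimately have "closed ((integer_lattice :: (real ^ 'n) set) - {0})"
    by (metis closed_Int)
  then have "closed ((*v) A ` (integer_lattice - {0}))"
    by (rule closed_injective_linear_image) (use inj in auto)
  moreover have "(*v) A ` (integer_lattice - {0}) = L - {0}"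
    using inj by (auto simp: A(2) lattice_of_def inj_def)
  ultimately have cl: "closed (L - {0})" by simp
  have "(1 :: real ^ 'n) \<in> integer_lattice" "(1 :: real ^ 'n) \<noteq> 0"
    by (auto simp: integer_lattice_def)
  then have "L - {0} \<noteq> {}"
    using \<open>(*v) A ` (integer_lattice - {0}) = L - {0}\<close> by blast
  with cl obtain y where y: "y \<in> L - {0}" "\<And>z. z \<in> L - {0} \<Longrightarrow> dist 0 y \<le> dist 0 z"
    by (metis distance_attains_inf)
  then have "min_norm L = norm y"
    unfolding min_norm_def by (intro cInf_eq_minimum) auto
  with y show "\<exists>x \<in> L - {0}. norm x = min_norm L"
    and "x \<in> L - {0} \<Longrightarrow> min_norm L \<le> norm x"
    by auto
qed

lemma quotient_map_lattice_of:
  "quotient_map (top_of_set {A. invertible A}) lattice_topology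
     (lattice_of :: real ^ 'n::finite ^ 'n \<Rightarrow> _)"
proof -
  let ?GL = "{A :: real ^ 'n ^ 'n. invertible A}"
  let ?P = "\<lambda>U. U \<subseteq> Collect is_lattice \<and>
     openin (top_of_set ?GL) {A. invertible A \<and> lattice_of A \<in> U}"
  have "istopology ?P"
    unfolding istopology_def
  proof (intro conjI allI impI)
    fix S T assume "?P S" "?P T"
    moreover have "{A. invertible A \<and> lattice_of A \<in> S \<inter> T} =
        {A. invertible A \<and> lattice_of A \<in> S} \<inter> {A. invertible A \<and> lattice_of A \<in> T}"
      by auto
    ultimately show "S \<inter> T \<subseteq> Collect is_lattice"
      and "openin (top_of_set ?GL) {A. invertible A \<and> lattice_of A \<in> S \<inter> T}"
      by (auto simp: openin_Int)
  next
    fix K assume K: "\<forall>S\<in>K. ?P S"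
    then show "\<Union>K \<subseteq> Collect is_lattice" by auto
    have "{A. invertible A \<and> lattice_of A \<in> \<Union>K} =
        \<Union>((\<lambda>S. {A. invertible A \<and> lattice_of A \<in> S}) ` K)"
      by auto
    then show "openin (top_of_set ?GL) {A. invertible A \<and> lattice_of A \<in> \<Union>K}"
      using K by (auto intro!: openin_Union)
  qed
  then have *: "openin lattice_topology = ?P"
    unfolding lattice_topology_def by (rule topology_inverse')
  have im: "lattice_of ` ?GL = Collect is_lattice"
    by (auto simp: is_lattice_def basis_matrix_def)
  have "{A. invertible A \<and> lattice_of A \<in> Collect is_lattice} = ?GL"
    using im by auto
  then have "?P (Collect is_lattice)"
    by (metis openin_topspace topspace_euclidean_subtopology subset_refl)
  then have top: "topspace (lattice_topology :: (real ^ 'n) set topology) = Collect is_lattice"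
    unfolding topspace_def * by blast
  show ?thesis
    unfolding quotient_map_def top * using im by auto
qed

lemma similar_lattices_refl: "similar_lattices L L"
proof -
  have "L = (\<lambda>x. 1 *\<^sub>R (mat 1 *v x)) ` L" by simp
  then show ?thesis
    unfolding similar_lattices_def using orthogonal_matrix_id zero_less_one by blast
qed

lemma similar_lattices_sym:
  assumes "similar_lattices L M"
  shows "similar_lattices M L"
proof -
  obtain \<alpha> U where *: "\<alpha> > 0" "orthogonal_matrix U" "M = (\<lambda>x. \<alpha> *\<^sub>R (U *v x)) ` L"
    using assms by (auto simp: similar_lattices_def)
  have "(1 / \<alpha>) *\<^sub>R (transpose U *v (\<alpha> *\<^sub>R (U *v x))) = x" for x
    using * by (simp add: matrix_vector_mult_scaleR matrix_vector_mul_assoc orthogonal_matrix)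
  then have "L = (\<lambda>x. (1 / \<alpha>) *\<^sub>R (transpose U *v x)) ` M"
    by (simp add: *(3) image_image)
  moreover have "orthogonal_matrix (transpose U)" using *(2) by simp
  moreover have "1 / \<alpha> > 0" using *(1) by simp
  ultimately show ?thesis unfolding similar_lattices_def by blast
qed

lemma similar_lattices_trans:
  assumes "similar_lattices L M" "similar_lattices M N"
  shows "similar_lattices L N"
proof -
  obtain \<alpha> U where 1: "\<alpha> > 0" "orthogonal_matrix U" "M = (\<lambda>x. \<alpha> *\<^sub>R (U *v x)) ` L"
    using assms(1) by (auto simp: similar_lattices_def)
  obtain \<beta> V where 2: "\<beta> > 0" "orthogonal_matrix V" "N = (\<lambda>x. \<beta> *\<^sub>R (V *v x)) ` M"
    using assms(2) by (auto simp: similar_lattices_def)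
  have "N = (\<lambda>x. (\<beta> * \<alpha>) *\<^sub>R ((V ** U) *v x)) ` L"
    by (simp add: 1(3) 2(3) image_image matrix_vector_mult_scaleR matrix_vector_mul_assoc)
  moreover have "orthogonal_matrix (V ** U)" using 1 2 by (simp add: orthogonal_matrix_mul)
  moreover have "\<beta> * \<alpha> > 0" using 1 2 by simp
  ultimately show ?thesis unfolding similar_lattices_def by blast
qed

lemma similarity_class_eq_iff:
  assumes "is_lattice L" "is_lattice M"
  shows "similarity_class L = similarity_class M \<longleftrightarrow> similar_lattices L M"
  unfolding similarity_class_def using assms
  by (blast intro: similar_lattices_refl similar_lattices_sym similar_lattices_trans)

end

theory Submission
  imports Defs
begin

text \<open>
  For an extreme lattice with basis \<open>b\<^sub>1, \<dots>, b\<^sub>n\<close> and indices \<open>i \<noteq> j\<close>, some minimal vector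
  \<open>\<Sum> z\<^sub>k b\<^sub>k\<close> has \<open>z\<^sub>i \<noteq> 0 \<noteq> z\<^sub>j\<close>: otherwise tilting \<open>b\<^sub>i\<close> at constant length, so that only its
  inner product with \<open>b\<^sub>j\<close> changes, decreases the determinant without shortening any minimal
  vector. If the basis is nearly orthogonal and the lattice well-rounded, all \<open>b\<^sub>k\<close> are minimal and
  such a \<open>z\<close> forces \<open>|b\<^sub>i \<bullet> b\<^sub>j| = |L|\<^sup>2 / 2\<close>, which cannot hold for all pairs among three basis
  vectors. In the plane, applying the same fact to a Gauss-reduced basis leaves only the hexagonal
  lattice. For well-rounded lattices, \<open>n\<close> independent minimal vectors and Hadamard's inequality
  give \<open>det L \<le> |L|\<^sup>n\<close>, with equality only for multiples of orthonormal bases.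
\<close>

section \<open>Lattices and their bases\<close>

lemma integer_lattice_closed [simp]:
  "x \<in> integer_lattice \<Longrightarrow> y \<in> integer_lattice \<Longrightarrow> x + y \<in> integer_lattice"
  "x \<in> integer_lattice \<Longrightarrow> y \<in> integer_lattice \<Longrightarrow> x - y \<in> integer_lattice"
  "c \<in> \<int> \<Longrightarrow> x \<in> integer_lattice \<Longrightarrow> c *\<^sub>R x \<in> integer_lattice"
  "c \<in> \<int> \<Longrightarrow> axis k c \<in> integer_lattice"
  "0 \<in> integer_lattice"
  by (auto simp: integer_lattice_def axis_def)

lemma finite_integer_lattice_bounded:
  "finite {x :: real ^ 'n::finite. x \<in> integer_lattice \<and> norm x \<le> R}"
proof -
  let ?S = "real_of_int ` {- \<lceil>R\<rceil>..\<lceil>R\<rceil>}"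
  have "{x :: real ^ 'n. x \<in> integer_lattice \<and> norm x \<le> R} \<subseteq> vec_lambda ` (UNIV \<rightarrow>\<^sub>E ?S)"
  proof
    fix x :: "real ^ 'n"
    assume x: "x \<in> {x. x \<in> integer_lattice \<and> norm x \<le> R}"
    have "x $ i \<in> ?S" for i
    proof -
      obtain a where a: "x $ i = of_int a"
        using x by (auto simp: integer_lattice_def elim: Ints_cases)
      have "\<bar>x $ i\<bar> \<le> R" using x component_le_norm_cart[of x i] by auto
      then have "a \<le> \<lceil>R\<rceil>" "- \<lceil>R\<rceil> \<le> a" using a by linarith+
      then show ?thesis using a by auto
    qed
    then show "x \<in> vec_lambda ` (UNIV \<rightarrow>\<^sub>E ?S)"
      by (intro image_eqI[where x = "vec_nth x"]) auto
  qed
  then show ?thesis by (rule finite_subset) (intro finite_imageI finite_PiE, auto)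
qed

lemma column_eq_axis: "column k A = A *v axis k 1"
  for A :: "real ^ 'n::finite ^ 'n"
  by (simp add: matrix_vector_mult_basis)

lemma lattice_ofI: "z \<in> integer_lattice \<Longrightarrow> A *v z \<in> lattice_of A"
  by (simp add: lattice_of_def)

lemma column_in_lattice_of [simp]: "column k A \<in> lattice_of A"
  unfolding column_eq_axis by (rule lattice_ofI) simp

lemma invertible_inj:
  fixes A :: "real ^ 'n::finite ^ 'n"
  assumes "invertible A"
  shows "A *v x = A *v y \<longleftrightarrow> x = y"
  using inj_matrix_vector_mult[OF assms] by (auto simp: inj_def)

lemma is_lattice_lattice_of: "invertible A \<Longrightarrow> is_lattice (lattice_of A)"
  by (auto simp: is_lattice_def basis_matrix_def)

lemma lattice_det_lattice_of: "invertible A \<Longrightarrow> lattice_det (lattice_of A) = \<bar>det A\<bar>"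
  by (rule lattice_det_eq) (simp add: basis_matrix_def)

lemma min_norm_pos: "is_lattice L \<Longrightarrow> 0 < min_norm L"
  using min_norm_attained(1) by (metis DiffD2 insertI1 zero_less_norm_iff)

lemma min_norm_le: "is_lattice L \<Longrightarrow> x \<in> L \<Longrightarrow> x \<noteq> 0 \<Longrightarrow> min_norm L \<le> norm x"
  using min_norm_attained(2) by blast

lemma min_norm_eqI:
  assumes "is_lattice L" "x \<in> L" "x \<noteq> 0" "\<And>y. y \<in> L \<Longrightarrow> y \<noteq> 0 \<Longrightarrow> norm x \<le> norm y"
  shows "min_norm L = norm x"
  using min_norm_attained(1)[OF assms(1)] min_norm_le[OF assms(1-3)] assms(4)
  by (metis DiffD1 DiffD2 insertI1 order_antisym)

lemma packing_density_lattice_of: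
  fixes A :: "real ^ 'n::finite ^ 'n"
  assumes "invertible A"
  shows "packing_density (lattice_of A) =
    measure lborel (ball (0 :: real ^ 'n) 1) / 2 ^ CARD('n) *
      (min_norm (lattice_of A) ^ CARD('n) / \<bar>det A\<bar>)"
  by (simp add: packing_density_def lattice_det_lattice_of assms)

lemma unit_ball_measure_pos: "0 < measure lborel (ball (0 :: real ^ 'n::finite) 1)"
  using content_ball_pos[of 1 "0 :: real ^ 'n"] by (simp add: measure_completion)

text \<open>The ball volume and the power of two form a common positive factor, so densities can be
  compared through minimal norm and determinant alone.\<close>

lemma packing_density_le_iff:
  fixes A B :: "real ^ 'n::finite ^ 'n"
  assumes "invertible A" "invertible B"
  shows "packing_density (lattice_of A) \<le> packing_density (lattice_of B) \<longleftrightarrow>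
    min_norm (lattice_of A) ^ CARD('n) / \<bar>det A\<bar> \<le> min_norm (lattice_of B) ^ CARD('n) / \<bar>det B\<bar>"
  unfolding packing_density_lattice_of[OF assms(1)] packing_density_lattice_of[OF assms(2)]
  by (intro mult_le_cancel_left_pos divide_pos_pos unit_ball_measure_pos) simp

section \<open>Integral changes of basis and sublattices\<close>

lemma integer_matrix_of_columns:
  fixes A X :: "real ^ 'n::finite ^ 'n"
  assumes "\<And>k. column k X \<in> lattice_of A"
  obtains U where "X = A ** U" "\<And>i j. U $ i $ j \<in> \<int>"
proof -
  obtain u where u: "\<And>k. u k \<in> integer_lattice" "\<And>k. column k X = A *v u k"
    using assms unfolding lattice_of_def image_iff by metis
  define U :: "real ^ 'n ^ 'n" where "U = (\<chi> i j. u j $ i)"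
  have "column k (A ** U) = A *v u k" for k
    by (simp add: vec_eq_iff column_def matrix_matrix_mult_def matrix_vector_mult_def U_def)
  then have "X = A ** U"
    using u(2) by (simp add: vec_eq_iff column_def)
  moreover have "U $ i $ j \<in> \<int>" for i j
    using u(1) by (simp add: U_def integer_lattice_def)
  ultimately show thesis using that by blast
qed

lemma integer_matrix_mult:
  fixes U :: "real ^ 'n::finite ^ 'n"
  assumes "\<And>i j. U $ i $ j \<in> \<int>" "z \<in> integer_lattice"
  shows "U *v z \<in> integer_lattice"
  using assms by (auto simp: integer_lattice_def matrix_vector_mult_def)

text \<open>The coefficient matrix \<open>U\<close> of the columns of \<open>X\<close> is integral
  with determinant plus or minus 1, so its inverse is integral as well.\<close>

lemma lattice_of_eqI:
  fixes A X :: "real ^ 'n::finite ^ 'n"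
  assumes A: "invertible A" and col: "\<And>k. column k X \<in> lattice_of A"
    and det: "\<bar>det X\<bar> = \<bar>det A\<bar>"
  shows "lattice_of X = lattice_of A"
proof -
  obtain U where U: "X = A ** U" "\<And>i j. U $ i $ j \<in> \<int>"
    using integer_matrix_of_columns[OF col] by blast
  have dU: "\<bar>det U\<bar> = 1"
    using A det by (simp add: U(1) det_mul abs_mult invertible_det_nz)
  have "x \<in> lattice_of X" if x: "x \<in> lattice_of A" for x
  proof -
    obtain z where z: "z \<in> integer_lattice" "x = A *v z"
      using x by (auto simp: lattice_of_def)
    \<comment> \<open>Cramer's formula for the solution of \<open>U *v y = z\<close>: the numerators
      are determinants of integral matrices and the denominator is plus or minus 1.\<close>
    define y where "y = (\<chi> k. det (\<chi> i j. if j = k then z $ i else U $ i $ j) / det U)"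
    have "U *v y = z" using dU by (subst cramer) (auto simp: y_def)
    moreover have "y \<in> integer_lattice"
      unfolding integer_lattice_def
    proof (clarify)
      fix k
      have "det (\<chi> i j. if j = k then z $ i else U $ i $ j) \<in> \<int>"
        using z U(2) by (intro det_Ints) (auto simp: integer_lattice_def)
      moreover have "det U = 1 \<or> det U = -1" using dU by auto
      ultimately show "y $ k \<in> \<int>" by (auto simp: y_def)
    qed
    ultimately show ?thesis
      using z(2) by (auto simp: lattice_of_def U(1) simp flip: matrix_vector_mul_assoc)
  qed
  moreover have "x \<in> lattice_of A" if "x \<in> lattice_of X" for x
    using that integer_matrix_mult[OF U(2)]
    by (auto simp: lattice_of_def U(1) simp flip: matrix_vector_mul_assoc)
  ultimately show ?thesis by blast
qed

text \<open>The determinants differ by the nonzero integer \<open>det U\<close>, up to sign the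
  index of the sublattice generated by the columns of \<open>X\<close>.\<close>

lemma lattice_of_det_ge:
  fixes A X :: "real ^ 'n::finite ^ 'n"
  assumes X: "invertible X" and col: "\<And>k. column k X \<in> lattice_of A"
  shows "\<bar>det A\<bar> \<le> \<bar>det X\<bar>"
proof -
  obtain U where U: "X = A ** U" "\<And>i j. U $ i $ j \<in> \<int>"
    using integer_matrix_of_columns[OF col] by blast
  have "det U \<noteq> 0" using X by (auto simp: invertible_det_nz U(1) det_mul)
  then have "1 \<le> \<bar>det U\<bar>" using U(2) by (intro Ints_nonzero_abs_ge1 det_Ints)
  then show ?thesis by (simp add: U(1) det_mul abs_mult mult_le_cancel_left1)
qed

text \<open>A Gram matrix determines a basis up to an orthogonal map; here that map is
  \<open>B ** C\<close>, with \<open>C\<close> the inverse of \<open>A\<close>, divided by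
  \<open>m\<close>.\<close>

lemma lattice_of_similar:
  fixes A B :: "real ^ 'n::finite ^ 'n"
  assumes A: "invertible A" and "invertible B" and "m > 0"
    and gram: "transpose B ** B = m\<^sup>2 *\<^sub>R (transpose A ** A)"
  shows "similar_lattices (lattice_of A) (lattice_of B)"
proof -
  obtain C where C: "A ** C = mat 1" "C ** A = mat 1"
    using A by (auto simp: invertible_def)
  define U where "U = (1 / m) *\<^sub>R (B ** C)"
  have "transpose U ** U = (1 / m)\<^sup>2 *\<^sub>R (transpose C ** (transpose B ** B) ** C)"
    by (simp add: U_def matrix_transpose_mul transpose_scalar scalar_matrix_assoc[symmetric]
        matrix_scalar_ac matrix_mul_assoc power2_eq_square)
  also have "\<dots> = transpose C ** (transpose A ** A) ** C"
    using \<open>m > 0\<close> by (simp add: gram scalar_matrix_assoc[symmetric] matrix_scalar_ac power2_eq_square)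
  also have "\<dots> = transpose (A ** C) ** (A ** C)"
    by (simp add: matrix_transpose_mul matrix_mul_assoc)
  finally have "orthogonal_matrix U" by (simp add: C orthogonal_matrix transpose_mat)
  moreover have "m *\<^sub>R (U *v (A *v z)) = B *v z" for z
    using \<open>m > 0\<close> C(2)
    by (simp add: U_def matrix_vector_mul_assoc
        flip: matrix_mul_assoc scalar_matrix_assoc scaleR_matrix_vector_assoc)
  then have "lattice_of B = (\<lambda>x. m *\<^sub>R (U *v x)) ` lattice_of A"
    by (simp add: lattice_of_def image_image)
  ultimately show ?thesis
    unfolding similar_lattices_def using \<open>m > 0\<close> by blast
qed

section \<open>Extreme lattices\<close>

text \<open>The quotient map makes the preimage of \<open>U\<close> relatively open in the
  invertible matrices, and these are open among all matrices.\<close>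

lemma eventually_lattice_of_in_open:
  fixes A :: "real ^ 'n::finite ^ 'n"
  assumes U: "openin lattice_topology U" and AU: "lattice_of A \<in> U" and A: "invertible A"
    and lim: "(X \<longlongrightarrow> A) F"
  shows "\<forall>\<^sub>F t in F. invertible (X t) \<and> lattice_of (X t) \<in> U"
proof -
  let ?GL = "{A :: real ^ 'n ^ 'n. invertible A}"
  have "U \<subseteq> topspace lattice_topology" using U by (rule openin_subset)
  then have "openin (top_of_set ?GL) {A \<in> ?GL. lattice_of A \<in> U}"
    using quotient_map_lattice_of[where 'n = 'n] U by (auto simp: quotient_map_def)
  moreover have "open ?GL"
  proof -
    have "?GL = (\<lambda>A. det A) -` (- {0})"
      by (auto simp: invertible_det_nz)
    moreover have "open ((\<lambda>A :: real ^ 'n ^ 'n. det A) -` (- {0}))"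
      by (intro open_vimage) (auto simp: det_def intro!: continuous_intros)
    ultimately show ?thesis by simp
  qed
  ultimately have "open {A \<in> ?GL. lattice_of A \<in> U}"
    using openin_open_trans by blast
  then show ?thesis
    using topological_tendstoD[OF lim, of "{A \<in> ?GL. lattice_of A \<in> U}"] A AU by auto
qed

lemma tendsto_matrix_vector_mult:
  fixes A :: "real ^ 'n::finite ^ 'm::finite"
  assumes "(X \<longlongrightarrow> A) F"
  shows "((\<lambda>t. X t *v z) \<longlongrightarrow> A *v z) F"
  unfolding matrix_vector_mult_def
  by (intro tendsto_vec_lambda tendsto_sum tendsto_mult tendsto_const tendsto_vec_nth assms)

text \<open>Vectors with large coordinates stay long uniformly; only finitely many others are left.\<close>

lemma min_norm_perturb:
  fixes A :: "real ^ 'n::finite ^ 'n"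
  assumes A: "invertible A" and lim: "(X \<longlongrightarrow> A) F"
    and min: "\<And>z. z \<in> integer_lattice \<Longrightarrow> norm (A *v z) = min_norm (lattice_of A) \<Longrightarrow>
      \<forall>\<^sub>F t in F. norm (A *v z) \<le> norm (X t *v z)"
  shows "\<forall>\<^sub>F t in F. \<forall>z\<in>integer_lattice - {0}. min_norm (lattice_of A) \<le> norm (X t *v z)"
proof -
  let ?m = "min_norm (lattice_of A)"
  \<comment> \<open>A lower bound for the stretching by the injective map \<open>A\<close>. Vectors
    of norm at least \<open>2 * ?m / b\<close> keep norm at least \<open>?m\<close> under every
    perturbation of operator norm below \<open>b / 2\<close>.\<close>
  obtain b where b: "b > 0" "\<And>z. b * norm z \<le> norm (A *v z)"
    using linear_inj_bounded_below_pos[of "(*v) A"] inj_matrix_vector_mult[OF A] by auto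
  \<comment> \<open>The sum of the absolute entries bounds the operator norm of the perturbation and
    tends to 0.\<close>
  let ?e = "\<lambda>t. \<Sum>i\<in>UNIV. \<Sum>j\<in>UNIV. \<bar>(X t - A) $ i $ j\<bar>"
  have "(?e \<longlongrightarrow> (\<Sum>i\<in>(UNIV::'n set). \<Sum>j\<in>(UNIV::'n set). \<bar>(A - A) $ i $ j\<bar>)) F"
    by (intro tendsto_intros lim)
  then have "\<forall>\<^sub>F t in F. ?e t < b / 2"
    using b(1) by (intro order_tendstoD(2)) auto
  then have large: "\<forall>\<^sub>F t in F. \<forall>z. norm z \<ge> 2 * ?m / b \<longrightarrow> ?m \<le> norm (X t *v z)"
  proof (rule eventually_mono, intro allI impI)
    fix t and z :: "real ^ 'n"
    assume e: "?e t < b / 2" and z: "2 * ?m / b \<le> norm z"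
    have "norm ((X t - A) *v z) \<le> onorm ((*v) (X t - A)) * norm z"
      by (intro onorm matrix_vector_mul_bounded_linear)
    also have "\<dots> \<le> ?e t * norm z"
      by (intro mult_right_mono onorm_le_matrix_component_sum) auto
    also have "\<dots> \<le> b / 2 * norm z"
      using e by (intro mult_right_mono) auto
    finally have "norm ((X t - A) *v z) \<le> b / 2 * norm z" .
    moreover have "norm (A *v z) \<le> norm (X t *v z) + norm ((X t - A) *v z)"
      using norm_triangle_ineq4[of "X t *v z" "(X t - A) *v z"]
      by (simp add: matrix_vector_mult_diff_rdistrib)
    moreover have "?m \<le> b / 2 * norm z"
      using z b(1) by (simp add: field_simps)
    ultimately show "?m \<le> norm (X t *v z)"
      using b(2)[of z] by simp
  qed
  \<comment> \<open>Over a finite set, pointwise eventual bounds combine: minimal vectors are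
    covered by the assumption \<open>min\<close>, all others by continuity of the norm.\<close>
  let ?S = "{z :: real ^ 'n. z \<in> integer_lattice \<and> norm z \<le> 2 * ?m / b} - {0}"
  have "\<forall>z\<in>?S. \<forall>\<^sub>F t in F. ?m \<le> norm (X t *v z)"
  proof
    fix z assume z: "z \<in> ?S"
    then have "A *v z \<noteq> 0" using invertible_inj[OF A, of z 0] by simp
    then have "?m \<le> norm (A *v z)"
      using z by (intro min_norm_le is_lattice_lattice_of A lattice_ofI) auto
    then consider "norm (A *v z) = ?m" | "?m < norm (A *v z)" by linarith
    then show "\<forall>\<^sub>F t in F. ?m \<le> norm (X t *v z)"
    proof cases
      case 1
      then show ?thesis using min[of z] z by simp
    next
      case 2
      have "((\<lambda>t. norm (X t *v z)) \<longlongrightarrow> norm (A *v z)) F"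
        by (intro tendsto_norm tendsto_matrix_vector_mult lim)
      from order_tendstoD(1)[OF this 2] show ?thesis
        by (rule eventually_mono) simp
    qed
  qed
  then have "\<forall>\<^sub>F t in F. \<forall>z\<in>?S. ?m \<le> norm (X t *v z)"
    using finite_integer_lattice_bounded by (intro eventually_ball_finite) auto
  with large show ?thesis
    by eventually_elim force
qed

text \<open>Along \<open>X\<close> the minimal norm does not drop while the determinant does, so
  lattices arbitrarily close to \<open>lattice_of A\<close> are strictly denser.\<close>

lemma extreme_not_perturb:
  fixes A :: "real ^ 'n::finite ^ 'n"
  assumes ext: "extreme (lattice_of A)" and A: "invertible A"
    and lim: "(X \<longlongrightarrow> A) F" and F: "F \<noteq> bot"
    and det: "\<forall>\<^sub>F t in F. \<bar>det (X t)\<bar> < \<bar>det A\<bar>"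
    and min: "\<And>z. z \<in> integer_lattice \<Longrightarrow> norm (A *v z) = min_norm (lattice_of A) \<Longrightarrow>
      \<forall>\<^sub>F t in F. norm (A *v z) \<le> norm (X t *v z)"
  shows False
proof -
  let ?m = "min_norm (lattice_of A)"
  obtain U where U: "openin lattice_topology U" "lattice_of A \<in> U"
    and le: "\<And>M. M \<in> U \<Longrightarrow> packing_density M \<le> packing_density (lattice_of A)"
    using ext by (auto simp: extreme_def)
  have "\<forall>\<^sub>F t in F. \<forall>z\<in>integer_lattice - {0}. ?m \<le> norm (X t *v z)"
    by (rule min_norm_perturb[OF A lim]) (rule min)
  then have "\<forall>\<^sub>F t in F. False"
    using eventually_lattice_of_in_open[OF U A lim] det
  proof eventually_elim
    case (elim t)
    let ?L = "lattice_of (X t)"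
    have L: "is_lattice ?L" using elim by (simp add: is_lattice_lattice_of)
    obtain z where "z \<in> integer_lattice" "X t *v z \<noteq> 0" "norm (X t *v z) = min_norm ?L"
      using min_norm_attained(1)[OF L] by (auto simp: lattice_of_def)
    with elim have "?m \<le> min_norm ?L"
      by (metis DiffI empty_iff insert_iff matrix_vector_mult_0_right)
    moreover have m: "0 < ?m" by (rule min_norm_pos[OF is_lattice_lattice_of[OF A]])
    ultimately have "?m ^ CARD('n) \<le> min_norm ?L ^ CARD('n)" by (intro power_mono) auto
    moreover have "0 < \<bar>det (X t)\<bar>" using elim by (simp add: invertible_det_nz)
    ultimately have "?m ^ CARD('n) / \<bar>det A\<bar> < min_norm ?L ^ CARD('n) / \<bar>det (X t)\<bar>"
      using elim m by (intro frac_less2) auto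
    then have "\<not> packing_density ?L \<le> packing_density (lattice_of A)"
      using elim A by (simp add: packing_density_le_iff)
    then show False using le[of ?L] elim by simp
  qed
  then show False using F by simp
qed

section \<open>Tilting one basis vector at constant length\<close>

lemma subspace_matrix_image:
  fixes A :: "real ^ 'n::finite ^ 'n"
  assumes "subspace Z"
  shows "subspace ((*v) A ` Z)"
  by (intro linear_subspace_image assms) auto

lemma matrix_vector_mult_replace_column:
  fixes A :: "real ^ 'n::finite ^ 'n"
  shows "(\<chi> r k. if k = i then v $ r else A $ r $ k) *v z = A *v z + z $ i *\<^sub>R (v - column i A)"
proof -
  have "(\<Sum>k\<in>UNIV. (if k = i then v $ r else A $ r $ k) * z $ k) =
      (\<Sum>k\<in>UNIV. A $ r $ k * z $ k + (if k = i then z $ i * (v $ r - A $ r $ i) else 0))" for r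
    by (intro sum.cong) (auto simp: algebra_simps)
  then show ?thesis
    by (simp add: vec_eq_iff matrix_vector_mult_def sum.distrib column_def)
qed

lemma norm_sum_squared:
  fixes x y :: "'a::real_inner"
  shows "(norm (a *\<^sub>R x + b *\<^sub>R y))\<^sup>2 = a\<^sup>2 * (norm x)\<^sup>2 + b\<^sup>2 * (norm y)\<^sup>2 + 2 * (a * b * (x \<bullet> y))"
  unfolding power2_norm_eq_inner
  by (simp add: inner_add_left inner_add_right inner_commute[of y x] power2_eq_square algebra_simps)

lemma subspace_orthogonal_decomp:
  fixes v :: "'a::euclidean_space"
  assumes "subspace V"
  obtains y h where "y \<in> V" "\<And>x. x \<in> V \<Longrightarrow> h \<bullet> x = 0" "v = y + h"
proof -
  have V: "span V = V" using assms by simp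
  obtain y h where "y \<in> span V" "\<And>x. x \<in> span V \<Longrightarrow> orthogonal h x" "v = y + h"
    using orthogonal_subspace_decomp_exists[of V v] by blast
  then show thesis using that unfolding V orthogonal_def by blast
qed

text \<open>
  If no minimal vector involves both \<open>i\<close> and \<open>j\<close>, move the \<open>i\<close>-th basis vector, keeping its norm
  and its inner products with all basis vectors except the \<open>j\<close>-th: no minimal vector changes its
  norm, but the component orthogonal to the remaining basis vectors, and with it the determinant,
  shrinks.
\<close>

lemma extreme_minimal_vector:
  fixes A :: "real ^ 'n::finite ^ 'n"
  assumes ext: "extreme (lattice_of A)" and A: "invertible A" and ij: "i \<noteq> j"
  obtains z where "z \<in> integer_lattice" "norm (A *v z) = min_norm (lattice_of A)"
    "z $ i \<noteq> 0" "z $ j \<noteq> 0"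
proof (rule ccontr)
  assume *: "\<not> thesis"
  note wit = that
  have no: "z $ i = 0 \<or> z $ j = 0"
    if "z \<in> integer_lattice" "norm (A *v z) = min_norm (lattice_of A)" for z
    using that * wit by blast
  \<comment> \<open>\<open>?V\<close> is spanned by all columns except the \<open>i\<close>-th,
    \<open>?W\<close> by all except the \<open>i\<close>-th and the \<open>j\<close>-th.\<close>
  let ?V = "(*v) A ` {z. z $ i = 0}" and ?W = "(*v) A ` {z. z $ i = 0 \<and> z $ j = 0}"
  have sub: "subspace ?V" "subspace ?W"
    by (rule subspace_matrix_image, simp add: subspace_def)+
  obtain p h where p: "p \<in> ?V" and h: "\<And>x. x \<in> ?V \<Longrightarrow> h \<bullet> x = 0" and ph: "column i A = p + h"
    using subspace_orthogonal_decomp[OF sub(1), of "column i A"] by blast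
  obtain q c' where q: "q \<in> ?W" and c': "\<And>x. x \<in> ?W \<Longrightarrow> c' \<bullet> x = 0" and qc: "column j A = q + c'"
    using subspace_orthogonal_decomp[OF sub(2), of "column j A"] by blast
  \<comment> \<open>Up to sign, \<open>c\<close> is the component of column \<open>j\<close>
    orthogonal to \<open>?W\<close>. The sign makes \<open>p + t *\<^sub>R c\<close> longer than
    \<open>p\<close> for \<open>t > 0\<close>, which leaves less length for the component along
    \<open>h\<close>.\<close>
  define c where "c = (if p \<bullet> c' \<ge> 0 then c' else - c')"
  have c: "c \<bullet> x = 0" if "x \<in> ?W" for x using c'[OF that] by (simp add: c_def)
  have pc: "p \<bullet> c \<ge> 0" by (auto simp: c_def)
  obtain zp where zp: "p = A *v zp" "zp $ i = 0" using p by auto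
  obtain zq where zq: "q = A *v zq" "zq $ i = 0" "zq $ j = 0" using q by auto
  have c'_eq: "c' = A *v (axis j 1 - zq)"
    using qc by (simp add: column_eq_axis zq(1) matrix_vector_mult_diff_distrib)
  have "(axis j 1 - zq) $ j \<noteq> 0" by (simp add: zq)
  then have "axis j 1 - zq \<noteq> 0" by fastforce
  then have "c' \<noteq> 0" using invertible_inj[OF A, of _ 0] by (simp add: c'_eq)
  then have "c \<noteq> 0" by (simp add: c_def)
  have "(axis j 1 - zq) $ i = 0" using ij by (simp add: zq axis_def)
  then have "c' \<in> ?V" using c'_eq by blast
  then have "c \<in> ?V" using subspace_neg[OF sub(1)] by (simp add: c_def)
  then obtain zc where zc: "c = A *v zc" "zc $ i = 0" by auto
  have h_eq: "h = A *v (axis i 1 - zp)"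
    using ph by (simp add: column_eq_axis zp(1) matrix_vector_mult_diff_distrib)
  have "(axis i 1 - zp) $ i \<noteq> 0" by (simp add: zp)
  then have "axis i 1 - zp \<noteq> 0" by fastforce
  then have "h \<noteq> 0" using invertible_inj[OF A, of _ 0] by (simp add: h_eq)
  \<comment> \<open>Chosen so that \<open>v t\<close> has the same norm as \<open>p + h\<close>,
    using that \<open>h\<close> is orthogonal to \<open>p\<close> and \<open>c\<close>.\<close>
  define g where "g t = 1 - (2 * t * (p \<bullet> c) + t\<^sup>2 * (c \<bullet> c)) / (h \<bullet> h)" for t
  define s where "s t = sqrt (g t)" for t
  define v where "v t = p + t *\<^sub>R c + s t *\<^sub>R h" for t
  define X where "X t = (\<chi> r k. if k = i then v t $ r else A $ r $ k)" for t
  have g_lim: "(g \<longlongrightarrow> 1) (at_right 0)"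
  proof -
    have "(g \<longlongrightarrow> 1 - (2 * 0 * (p \<bullet> c) + 0\<^sup>2 * (c \<bullet> c)) / (h \<bullet> h)) (at_right 0)"
      unfolding g_def using \<open>h \<noteq> 0\<close> by (intro tendsto_intros) auto
    then show ?thesis by simp
  qed
  have "(s \<longlongrightarrow> sqrt 1) (at_right 0)"
    unfolding s_def by (intro tendsto_real_sqrt g_lim)
  then have s_lim: "(s \<longlongrightarrow> 1) (at_right 0)" by simp
  have "(v \<longlongrightarrow> p + 0 *\<^sub>R c + 1 *\<^sub>R h) (at_right 0)"
    unfolding v_def by (intro tendsto_intros s_lim)
  then have v_lim: "(v \<longlongrightarrow> column i A) (at_right 0)" by (simp add: ph)
  have X_lim: "(X \<longlongrightarrow> A) (at_right 0)"
  proof -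
    have "(X \<longlongrightarrow> (\<chi> r k. if k = i then column i A $ r else A $ r $ k)) (at_right 0)"
      unfolding X_def
    proof (intro tendsto_vec_lambda)
      fix r k
      show "((\<lambda>t. if k = i then v t $ r else A $ r $ k) \<longlongrightarrow>
          (if k = i then column i A $ r else A $ r $ k)) (at_right 0)"
        by (cases "k = i") (auto intro!: tendsto_vec_nth v_lim)
    qed
    also have "(\<chi> r k. if k = i then column i A $ r else A $ r $ k) = A"
      by (simp add: vec_eq_iff column_def)
    finally show ?thesis .
  qed
  have ev: "\<forall>\<^sub>F t in at_right 0. 0 < g t \<and> 0 < t"
    using order_tendstoD(1)[OF g_lim, of 0] eventually_at_right_less[of 0]
    by (auto simp: eventually_conj_iff)
  \<comment> \<open>Replacing a column multiplies the determinant by the corresponding coordinate of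
    the new column. Since \<open>p\<close> and \<open>c\<close> lie in \<open>?V\<close>, only the
    multiple of \<open>h\<close> contributes to it.\<close>
  have det_X: "det (X t) = s t * det A" for t
  proof -
    have vt: "v t = A *v (zp + t *\<^sub>R zc + s t *\<^sub>R (axis i 1 - zp))"
      by (simp add: v_def h_eq zp(1) zc(1) matrix_vector_right_distrib matrix_vector_mult_scaleR)
    show ?thesis
      unfolding X_def vt cramer_lemma by (simp add: zp(2) zc(2))
  qed
  have g_less: "g t < 1" if "0 < t" for t
  proof -
    have "0 \<le> 2 * t * (p \<bullet> c)" using that pc by simp
    moreover have "0 < t\<^sup>2 * (c \<bullet> c)" using that \<open>c \<noteq> 0\<close> by simp
    ultimately show ?thesis
      using \<open>h \<noteq> 0\<close> unfolding g_def by (simp add: add_nonneg_pos)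
  qed
  show False
  proof (rule extreme_not_perturb[OF ext A X_lim])
    show "at_right (0::real) \<noteq> bot" by simp
    show "\<forall>\<^sub>F t in at_right 0. \<bar>det (X t)\<bar> < \<bar>det A\<bar>"
      using ev
    proof eventually_elim
      case (elim t)
      then have "\<bar>s t\<bar> < 1" using g_less[of t] by (simp add: s_def)
      moreover have "det A \<noteq> 0" using A by (simp add: invertible_det_nz)
      ultimately show ?case by (simp add: det_X abs_mult)
    qed
  next
    fix z assume "z \<in> integer_lattice" "norm (A *v z) = min_norm (lattice_of A)"
    from no[OF this] show "\<forall>\<^sub>F t in at_right 0. norm (A *v z) \<le> norm (X t *v z)"
    proof
      assume "z $ i = 0"
      then show ?thesis by (simp add: X_def matrix_vector_mult_replace_column)
    next
      assume zj: "z $ j = 0"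
      \<comment> \<open>The vector \<open>A *v z\<close> without its \<open>i\<close>-th summand. As
        \<open>z $ j = 0\<close>, it lies in \<open>?W\<close> and is orthogonal to both
        \<open>c\<close> and \<open>h\<close>, so the tilt does not change its inner product with
        the moved column.\<close>
      define r where "r = A *v (z - z $ i *\<^sub>R axis i 1)"
      have r: "r \<in> ?W"
        unfolding r_def using zj ij by (intro imageI) (auto simp: axis_def)
      have "r \<in> ?V" using r by auto
      have Az: "A *v z = r + z $ i *\<^sub>R (p + h)"
        by (simp add: r_def matrix_vector_mult_diff_distrib matrix_vector_mult_scaleR column_eq_axis
            flip: ph)
      have rc: "r \<bullet> c = 0" "c \<bullet> r = 0" using c[OF r] by (simp_all add: inner_commute)
      have rh: "r \<bullet> h = 0" "h \<bullet> r = 0" using h[OF \<open>r \<in> ?V\<close>] by (simp_all add: inner_commute)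
      have hp: "h \<bullet> p = 0" "p \<bullet> h = 0" using h[OF p] by (simp_all add: inner_commute)
      have hc: "h \<bullet> c = 0" "c \<bullet> h = 0" using h[OF \<open>c \<in> ?V\<close>] by (simp_all add: inner_commute)
      show ?thesis
        using ev
      proof eventually_elim
        case (elim t)
        have Xz: "X t *v z = r + z $ i *\<^sub>R v t"
          by (simp add: X_def matrix_vector_mult_replace_column Az ph algebra_simps)
        have s2: "(s t)\<^sup>2 = g t" using elim by (simp add: s_def)
        have "(s t)\<^sup>2 * (h \<bullet> h) = h \<bullet> h - 2 * t * (p \<bullet> c) - t\<^sup>2 * (c \<bullet> c)"
          using \<open>h \<noteq> 0\<close> unfolding s2 by (simp add: g_def field_simps)
        moreover have "v t \<bullet> v t = p \<bullet> p + 2 * t * (p \<bullet> c) + t\<^sup>2 * (c \<bullet> c) + (s t)\<^sup>2 * (h \<bullet> h)"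
          by (simp add: v_def inner_add_left inner_add_right hp hc inner_commute[of c p]
              power2_eq_square algebra_simps)
        ultimately have "v t \<bullet> v t = (p + h) \<bullet> (p + h)"
          by (simp add: inner_add_left inner_add_right hp)
        moreover have "r \<bullet> v t = r \<bullet> (p + h)"
          by (simp add: v_def inner_add_right rc rh)
        ultimately have "(norm (X t *v z))\<^sup>2 = (norm (A *v z))\<^sup>2"
          using norm_sum_squared[of 1 r "z $ i"] by (simp add: Xz Az power2_norm_eq_inner)
        then show ?case by simp
      qed
    qed
  qed
qed

section \<open>Hadamard's inequality and the integer lattice\<close>

lemma row_nth: "row k A = A $ k"
  by (simp add: row_def)

text \<open>Gram-Schmidt, one row at a time: subtracting from row \<open>i\<close> its projection
  onto the span of all other rows keeps the determinant and does not lengthen the row. Rows treated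
  earlier stay orthogonal to all others, the new row included. The last conjunct prepares the
  equality case, since a nonzero projection strictly shortens its row.\<close>

lemma orthogonalize_rows:
  fixes A :: "real ^ 'n::finite ^ 'n"
  assumes "finite I"
  shows "\<exists>B. det B = det A \<and> (\<forall>k. norm (row k B) \<le> norm (row k A)) \<and>
    (\<forall>i\<in>I. \<forall>k. k \<noteq> i \<longrightarrow> row i B \<bullet> row k B = 0) \<and>
    ((\<forall>k. norm (row k B) = norm (row k A)) \<longrightarrow> B = A)"
  using assms
proof (induction I rule: finite_induct)
  case empty
  show ?case by (intro exI[of _ A]) auto
next
  case (insert i I)
  obtain B where "det B = det A \<and> (\<forall>k. norm (row k B) \<le> norm (row k A)) \<and>
    (\<forall>i\<in>I. \<forall>k. k \<noteq> i \<longrightarrow> row i B \<bullet> row k B = 0) \<and>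
    ((\<forall>k. norm (row k B) = norm (row k A)) \<longrightarrow> B = A)"
    using insert.IH by (elim exE)
  then have B: "det B = det A" "\<And>k. norm (row k B) \<le> norm (row k A)"
    "\<And>l k. l \<in> I \<Longrightarrow> k \<noteq> l \<Longrightarrow> row l B \<bullet> row k B = 0"
    "\<forall>k. norm (row k B) = norm (row k A) \<Longrightarrow> B = A"
    by simp_all
  obtain p h where p: "p \<in> span {row k B |k. k \<noteq> i}"
    and h: "\<And>x. x \<in> span {row k B |k. k \<noteq> i} \<Longrightarrow> h \<bullet> x = 0" and ph: "row i B = p + h"
    using subspace_orthogonal_decomp[OF subspace_span, of _ "row i B"] by blast
  define C where "C = (\<chi> k. if k = i then row i B + (- p) else row k B)"
  have C: "row k C = (if k = i then h else row k B)" for k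
    by (simp add: row_nth C_def ph[unfolded row_nth])
  have "det C = det B"
    unfolding C_def using p by (intro det_row_span) (simp add: span_vec_eq span_neg)
  moreover have pyth: "(norm (row i B))\<^sup>2 = (norm p)\<^sup>2 + (norm h)\<^sup>2"
    using h[OF p] by (simp add: ph power2_norm_eq_inner inner_add_left inner_add_right inner_commute)
  have "(norm h)\<^sup>2 \<le> (norm (row i B))\<^sup>2" unfolding pyth by simp
  then have "norm h \<le> norm (row i B)" by (rule power2_le_imp_le) simp
  then have le: "norm (row k C) \<le> norm (row k B)" for k
    by (simp add: C)
  then have "norm (row k C) \<le> norm (row k A)" for k
    using B(2) order_trans by blast
  moreover have h0: "h \<bullet> row k B = 0" if "k \<noteq> i" for k
    using that by (intro h span_base) auto
  have "row l C \<bullet> row k C = 0" if "l \<in> insert i I" "k \<noteq> l" for l k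
    using that h0[of l] h0[of k] B(3)[of l k] inner_commute[of h "row l B"]
    by (cases "l = i"; cases "k = i") (auto simp: C)
  moreover have "C = A" if eq: "\<forall>k. norm (row k C) = norm (row k A)"
  proof -
    have eqB: "norm (row k B) = norm (row k A)" for k
      using le[of k] B(2)[of k] eq by (metis order_antisym)
    then have "norm h = norm (row i B)" using eq[rule_format, of i] by (simp add: C)
    then have "p = 0" using pyth by simp
    then have "row k C = row k B" for k by (simp add: C ph)
    then have "C = B" by (simp add: vec_eq_iff row_def)
    then show ?thesis using B(4) eqB by blast
  qed
  ultimately show ?case
    using B(1) by (intro exI[of _ C]) simp
qed

lemma gram_component:
  fixes A :: "real ^ 'n::finite ^ 'n"
  shows "(transpose A ** A) $ i $ j = column i A \<bullet> column j A"
  by (simp add: matrix_matrix_mult_def transpose_def column_def inner_vec_def)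

text \<open>For the orthogonalized rows the Gram matrix is diagonal, so the absolute determinant is
  the product of their norms. In the equality case no row was shortened, hence
  \<open>B = transpose A\<close> and the columns of \<open>A\<close> were orthogonal from the
  start.\<close>

lemma Hadamard_inequality:
  fixes A :: "real ^ 'n::finite ^ 'n"
  shows "\<bar>det A\<bar> \<le> (\<Prod>k\<in>UNIV. norm (column k A))"
    and "invertible A \<Longrightarrow> \<bar>det A\<bar> = (\<Prod>k\<in>UNIV. norm (column k A)) \<Longrightarrow> i \<noteq> j \<Longrightarrow>
      column i A \<bullet> column j A = 0"
proof -
  obtain B where B: "det B = det A" "\<And>k. norm (row k B) \<le> norm (column k A)"
    "\<And>i k. k \<noteq> i \<Longrightarrow> row i B \<bullet> row k B = 0"
    "(\<forall>k. norm (row k B) = norm (column k A)) \<Longrightarrow> B = transpose A"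
    using orthogonalize_rows[of UNIV "transpose A"] by (auto simp: det_transpose)
  \<comment> \<open>The Gram matrix of the rows of \<open>B\<close>, written with a double transpose
    so that \<open>gram_component\<close> applies.\<close>
  let ?D = "transpose (transpose B) ** transpose B"
  have D: "?D $ i $ j = (if i = j then (norm (row i B))\<^sup>2 else 0)" for i j
    unfolding gram_component using B(3) by (simp add: power2_norm_eq_inner)
  have "det ?D = (\<Prod>k\<in>UNIV. ?D $ k $ k)"
    by (rule det_diagonal) (simp add: D del: transpose_transpose)
  then have "(det B)\<^sup>2 = (\<Prod>k\<in>UNIV. norm (row k B))\<^sup>2"
    unfolding D by (simp add: det_mul det_transpose power2_eq_square prod.distrib)
  then have "\<bar>det B\<bar> = \<bar>\<Prod>k\<in>UNIV. norm (row k B)\<bar>"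
    by (simp only: power2_eq_iff abs_eq_iff)
  then have det: "\<bar>det A\<bar> = (\<Prod>k\<in>UNIV. norm (row k B))"
    by (simp add: B(1) prod_nonneg)
  show "\<bar>det A\<bar> \<le> (\<Prod>k\<in>UNIV. norm (column k A))"
    unfolding det using B(2) by (intro prod_mono) auto
  assume A: "invertible A" and eq: "\<bar>det A\<bar> = (\<Prod>k\<in>UNIV. norm (column k A))" and ij: "i \<noteq> j"
  have pos: "0 < norm (column k A)" for k
  proof -
    have "det A \<noteq> 0" using A by (simp add: invertible_det_nz)
    then have "(\<Prod>k\<in>UNIV. norm (column k A)) \<noteq> 0" using eq by (metis abs_eq_0)
    then show ?thesis by simp
  qed
  \<comment> \<open>All column norms are positive, so a single shorter row would make the whole
    product strictly smaller.\<close>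
  have "norm (row k B) = norm (column k A)" for k
  proof (rule ccontr)
    assume "norm (row k B) \<noteq> norm (column k A)"
    then have "norm (row k B) < norm (column k A)" using B(2)[of k] by simp
    then have "(\<Prod>k\<in>UNIV. norm (row k B)) < (\<Prod>k\<in>UNIV. norm (column k A))"
      using B(2) pos by (intro prod_mono_strict[of k]) auto
    then show False using det eq by simp
  qed
  then have "B = transpose A" using B(4) by blast
  then show "column i A \<bullet> column j A = 0" using B(3)[of j i] ij by simp
qed

section \<open>Well-rounded lattices and the density of the integer lattice\<close>

lemma lattice_of_mat_1: "lattice_of (mat 1) = integer_lattice"
  by (simp add: lattice_of_def)

lemma invertible_mat_1: "invertible (mat 1 :: real ^ 'n::finite ^ 'n)"
  by (simp add: invertible_det_nz)

lemma span_lattice_of: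
  fixes A :: "real ^ 'n::finite ^ 'n"
  assumes "invertible A"
  shows "span (lattice_of A) = UNIV"
proof -
  have "vec.span (columns A) = UNIV"
    using assms by (auto simp: invertible_def simp flip: matrix_right_invertible_span_columns)
  moreover have "span (columns A) \<subseteq> span (lattice_of A)"
    by (intro span_mono) (auto simp: columns_def)
  ultimately show ?thesis by (auto simp: span_vec_eq)
qed

lemma invertible_columns_spanI:
  fixes A :: "real ^ 'n::finite ^ 'n"
  assumes "span (columns A) = UNIV"
  shows "invertible A"
  using assms matrix_right_invertible_span_columns[of A] by (simp add: span_vec_eq invertible_right_inverse)

lemma well_roundedI:
  fixes A :: "real ^ 'n::finite ^ 'n"
  assumes A: "invertible A" and min: "\<And>k. norm (column k A) = min_norm (lattice_of A)"
  shows "well_rounded (lattice_of A)"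
proof -
  have "vec.span (columns A) = UNIV"
    using A by (auto simp: invertible_def simp flip: matrix_right_invertible_span_columns)
  moreover have "span (columns A) \<subseteq> span (min_vectors (lattice_of A))"
    using min by (intro span_mono) (auto simp: columns_def min_vectors_def)
  ultimately show ?thesis
    using A by (auto simp: well_rounded_def is_lattice_lattice_of span_lattice_of span_vec_eq)
qed

text \<open>A maximal independent set of minimal vectors spans the space and so fills the columns of
  a square matrix. The columns generate a sublattice of \<open>L\<close>, possibly a proper
  one.\<close>

lemma well_rounded_minimal_matrix:
  fixes L :: "(real ^ 'n::finite) set"
  assumes "well_rounded L"
  obtains X :: "real ^ 'n ^ 'n" where "invertible X" "\<And>k. column k X \<in> min_vectors L"
proof -
  obtain A where "invertible A" "L = lattice_of A"
    using assms by (auto simp: well_rounded_def is_lattice_def basis_matrix_def)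
  then have span: "span (min_vectors L) = UNIV"
    using assms by (simp add: well_rounded_def span_lattice_of)
  obtain B where B: "B \<subseteq> min_vectors L" "independent B" "min_vectors L \<subseteq> span B"
    by (metis maximal_independent_subset)
  have "span B = UNIV"
    using B(3) span span_minimal[OF B(3)] by auto
  then have "card B = CARD('n)" "finite B"
    using B(2) basis_card_eq_dim[of B UNIV] by (auto simp: independent_imp_finite)
  then obtain f where f: "bij_betw f (UNIV :: 'n set) B"
    by (metis finite_class.finite_UNIV finite_same_card_bij)
  define X where "X = (\<chi> r k. f k $ r)"
  have X: "column k X = f k" for k by (simp add: X_def column_def vec_eq_iff)
  have "columns X = B" using f by (auto simp: columns_def X bij_betw_def)
  then have "invertible X" using \<open>span B = UNIV\<close> by (intro invertible_columns_spanI) simp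
  moreover have "column k X \<in> min_vectors L" for k
    using f B(1) by (auto simp: X bij_betw_def)
  ultimately show thesis using that by blast
qed

lemma min_norm_integer_lattice: "min_norm (integer_lattice :: (real ^ 'n::finite) set) = 1"
proof -
  fix k :: 'n
  have "min_norm (integer_lattice :: (real ^ 'n) set) = norm (axis k 1 :: real ^ 'n)"
  proof (rule min_norm_eqI)
    show "is_lattice (integer_lattice :: (real ^ 'n) set)"
      using is_lattice_lattice_of[OF invertible_mat_1] by (simp add: lattice_of_mat_1)
    fix y :: "real ^ 'n" assume y: "y \<in> integer_lattice" "y \<noteq> 0"
    then obtain i where "y $ i \<noteq> 0" by (auto simp: vec_eq_iff)
    then have "1 \<le> \<bar>y $ i\<bar>"
      using y by (intro Ints_nonzero_abs_ge1) (auto simp: integer_lattice_def)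
    then show "norm (axis k 1 :: real ^ 'n) \<le> norm y"
      using component_le_norm_cart[of y i] by simp
  qed auto
  then show ?thesis by simp
qed

lemma well_rounded_integer_lattice: "well_rounded (integer_lattice :: (real ^ 'n::finite) set)"
proof -
  have "column k (mat 1 :: real ^ 'n ^ 'n) = axis k 1" for k
    by (simp add: column_eq_axis)
  then show ?thesis
    using well_roundedI[OF invertible_mat_1, where 'n = 'n]
    by (simp add: lattice_of_mat_1 min_norm_integer_lattice)
qed

text \<open>With independent minimal vectors as the columns of \<open>X\<close>, the index bound and
  Hadamard's inequality give the chain \<open>\<bar>det A\<bar> \<le> \<bar>det X\<bar> \<le> ?m ^
  CARD('n)\<close>. Equality throughout makes \<open>X\<close> a basis of \<open>L\<close> with
  orthogonal columns of equal length.\<close>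

lemma well_rounded_packing_density:
  fixes L :: "(real ^ 'n::finite) set"
  assumes "well_rounded L"
  shows "packing_density (integer_lattice :: (real ^ 'n) set) \<le> packing_density L"
    and "packing_density L \<le> packing_density (integer_lattice :: (real ^ 'n) set) \<Longrightarrow>
      similar_lattices integer_lattice L"
proof -
  obtain A where A: "invertible A" "L = lattice_of A"
    using assms by (auto simp: well_rounded_def is_lattice_def basis_matrix_def)
  let ?m = "min_norm L"
  have m: "0 < ?m" using A by (simp add: min_norm_pos is_lattice_lattice_of)
  obtain X :: "real ^ 'n ^ 'n" where X: "invertible X" "\<And>k. column k X \<in> min_vectors L"
    using well_rounded_minimal_matrix[OF assms] by blast
  have col: "column k X \<in> lattice_of A" "norm (column k X) = ?m" for k
    using X(2)[of k] by (auto simp: min_vectors_def A(2))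
  have detA: "0 < \<bar>det A\<bar>" using A(1) by (simp add: invertible_det_nz)
  have "\<bar>det A\<bar> \<le> \<bar>det X\<bar>" by (rule lattice_of_det_ge[OF X(1) col(1)])
  moreover have "\<bar>det X\<bar> \<le> ?m ^ CARD('n)"
    using Hadamard_inequality(1)[of X] by (simp add: col(2))
  ultimately have le: "\<bar>det A\<bar> \<le> \<bar>det X\<bar>" "\<bar>det X\<bar> \<le> ?m ^ CARD('n)" .
  have *: "packing_density (integer_lattice :: (real ^ 'n) set) \<le> packing_density L \<longleftrightarrow>
      1 \<le> ?m ^ CARD('n) / \<bar>det A\<bar>"
    using packing_density_le_iff[OF invertible_mat_1 A(1)]
    by (simp add: A(2) lattice_of_mat_1 min_norm_integer_lattice)
  have **: "packing_density L \<le> packing_density (integer_lattice :: (real ^ 'n) set) \<longleftrightarrow>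
      ?m ^ CARD('n) / \<bar>det A\<bar> \<le> 1"
    using packing_density_le_iff[OF A(1) invertible_mat_1]
    by (simp add: A(2) lattice_of_mat_1 min_norm_integer_lattice)
  show "packing_density (integer_lattice :: (real ^ 'n) set) \<le> packing_density L"
    unfolding * using le detA by (simp add: field_simps)
  assume "packing_density L \<le> packing_density (integer_lattice :: (real ^ 'n) set)"
  then have "?m ^ CARD('n) \<le> \<bar>det A\<bar>"
    unfolding ** using detA by (simp add: field_simps)
  with le have eq: "\<bar>det X\<bar> = \<bar>det A\<bar>" "\<bar>det X\<bar> = ?m ^ CARD('n)" by auto
  have "lattice_of X = L"
    unfolding A(2) using lattice_of_eqI[OF A(1) col(1) eq(1)] .
  moreover have "transpose X ** X = ?m\<^sup>2 *\<^sub>R (transpose (mat 1) ** mat 1)"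
  proof -
    have "column i X \<bullet> column j X = 0" if "i \<noteq> j" for i j
      using that eq(2) by (intro Hadamard_inequality(2)[OF X(1)]) (simp_all add: col(2))
    moreover have "column i X \<bullet> column i X = ?m\<^sup>2" for i
      using col(2)[of i] by (simp add: power2_norm_eq_inner[symmetric])
    ultimately show ?thesis
      by (simp add: vec_eq_iff gram_component transpose_mat) (simp add: mat_def)
  qed
  then have "similar_lattices (lattice_of (mat 1)) (lattice_of X)"
    by (intro lattice_of_similar[OF invertible_mat_1 X(1) m])
  ultimately show "similar_lattices integer_lattice L"
    by (simp add: lattice_of_mat_1)
qed

section \<open>Nearly orthogonal bases\<close>

lemma cosine_bounds:
  fixes v w :: "'a::real_inner"
  shows "- 1 \<le> (v \<bullet> w) / (norm v * norm w)" "(v \<bullet> w) / (norm v * norm w) \<le> 1"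
proof -
  let ?q = "(v \<bullet> w) / (norm v * norm w)"
  have "\<bar>?q\<bar> \<le> 1"
    using Cauchy_Schwarz_ineq2[of v w] by (cases "v = 0 \<or> w = 0") (auto simp: abs_mult)
  then have "?q \<le> 1 \<and> - ?q \<le> 1" by (simp only: abs_le_iff)
  then show "- 1 \<le> ?q" "?q \<le> 1" by linarith+
qed

lemma pi_third_le_arccos_iff:
  assumes "- 1 \<le> x" "x \<le> 1"
  shows "pi / 3 \<le> arccos x \<longleftrightarrow> x \<le> 1 / 2"
proof -
  have "pi / 3 = arccos (1 / 2)" using arccos_cos[of "pi / 3"] by (simp add: cos_60)
  then show ?thesis using assms arccos_le_mono[of "1 / 2" x] by simp
qed

text \<open>As \<open>arccos\<close> is decreasing, a lower bound on the smallest angle is an upper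
  bound on every cosine; clearing denominators admits \<open>w = 0\<close>. A nonzero vector in
  \<open>S\<close> keeps the infimum from ranging over the empty set.\<close>

lemma pi_third_le_subspace_angle_iff:
  fixes v :: "real ^ 'n::finite"
  assumes S: "\<not> S \<subseteq> {0}" and v: "v \<noteq> 0"
  shows "pi / 3 \<le> subspace_angle v S \<longleftrightarrow> (\<forall>w\<in>S. 2 * (v \<bullet> w) \<le> norm v * norm w)"
proof -
  have "pi / 3 \<le> subspace_angle v S \<longleftrightarrow> (\<forall>w\<in>S - {0}. pi / 3 \<le> arccos ((v \<bullet> w) / (norm v * norm w)))"
    unfolding subspace_angle_def
    using S by (intro le_cINF_iff bdd_belowI2[of _ 0] arccos_lbound cosine_bounds) auto
  also have "\<dots> \<longleftrightarrow> (\<forall>w\<in>S - {0}. 2 * (v \<bullet> w) \<le> norm v * norm w)"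
    using v by (intro ball_cong refl, subst pi_third_le_arccos_iff[OF cosine_bounds])
      (simp add: divide_le_eq mult.commute)
  also have "\<dots> \<longleftrightarrow> (\<forall>w\<in>S. 2 * (v \<bullet> w) \<le> norm v * norm w)" by auto
  finally show ?thesis .
qed

lemma column_eq_iff:
  fixes A :: "real ^ 'n::finite ^ 'n"
  assumes "invertible A"
  shows "column i A = column j A \<longleftrightarrow> i = j"
  by (simp add: column_eq_axis invertible_inj[OF assms] axis_eq_axis)

lemma column_nonzero:
  fixes A :: "real ^ 'n::finite ^ 'n"
  assumes "invertible A"
  shows "column i A \<noteq> 0"
  using invertible_inj[OF assms, of "axis i 1" 0] by (simp add: column_eq_axis)

text \<open>Passing to coordinates turns membership in the span of the other basis vectors into the
  vanishing of one coordinate.\<close>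

lemma span_other_columns:
  fixes A :: "real ^ 'n::finite ^ 'n"
  assumes A: "invertible A"
  shows "span (columns A - {column k A}) = (*v) A ` {z. z $ k = 0}"
proof
  have "column i A \<in> (*v) A ` {z. z $ k = 0}" if "column i A \<noteq> column k A" for i
    unfolding column_eq_axis[of i] using that by (intro imageI) (auto simp: axis_def)
  then have "columns A - {column k A} \<subseteq> (*v) A ` {z. z $ k = 0}"
    by (auto simp: columns_def)
  moreover have "subspace ((*v) A ` {z. z $ k = 0})"
    by (rule subspace_matrix_image) (simp add: subspace_def)
  ultimately show "span (columns A - {column k A}) \<subseteq> (*v) A ` {z. z $ k = 0}"
    by (rule span_minimal)
  have "A *v z \<in> span (columns A - {column k A})" if "z $ k = 0" for z
    unfolding matrix_mult_sum
  proof (rule span_sum)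
    fix i
    show "z $ i *s column i A \<in> span (columns A - {column k A})"
    proof (cases "i = k")
      case False
      then have "column i A \<in> columns A - {column k A}"
        using column_eq_iff[OF A] by (auto simp: columns_def)
      then show ?thesis by (simp add: scalar_mult_eq_scaleR span_base span_scale)
    qed (use that in \<open>simp add: span_zero\<close>)
  qed
  then show "(*v) A ` {z. z $ k = 0} \<subseteq> span (columns A - {column k A})" by auto
qed

text \<open>The strongest condition on column \<open>k\<close> arises when it comes last in the
  ordering; in any other position its predecessors span a subspace of the same span.\<close>

lemma nearly_orthogonal_columns_iff:
  fixes A :: "real ^ 'n::finite ^ 'n"
  assumes A: "invertible A"
  shows "nearly_orthogonal (columns A) \<longleftrightarrow>
    (\<forall>k z. z $ k = 0 \<longrightarrow> 2 * (column k A \<bullet> (A *v z)) \<le> norm (column k A) * norm (A *v z))"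
    (is "_ \<longleftrightarrow> ?rhs")
proof
  assume no: "nearly_orthogonal (columns A)"
  show ?rhs
  proof (intro allI impI)
    fix k and z :: "real ^ 'n" assume z: "z $ k = 0"
    show "2 * (column k A \<bullet> (A *v z)) \<le> norm (column k A) * norm (A *v z)"
    proof (cases "z = 0")
      case False
      obtain xs where xs: "set xs = columns A - {column k A}" "distinct xs"
        using finite_distinct_list[of "columns A - {column k A}"]
        by (auto simp: columns_def full_SetCompr_eq)
      let ?bs = "xs @ [column k A]"
      have Az: "A *v z \<in> span (set xs)" "A *v z \<noteq> 0"
        using z False invertible_inj[OF A, of z 0] unfolding xs(1) span_other_columns[OF A] by auto
      then have "xs \<noteq> []" by auto
      have "distinct ?bs" "set ?bs = columns A"
        using xs by (auto simp: columns_def)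
      then have "weakly_nearly_orthogonal ?bs"
        using no by (simp add: nearly_orthogonal_def)
      then have "pi / 3 \<le> subspace_angle (?bs ! length xs) (span (set (take (length xs) ?bs)))"
        using \<open>xs \<noteq> []\<close> unfolding weakly_nearly_orthogonal_def
        by (metis One_nat_def Suc_leI length_append_singleton length_greater_0_conv lessI)
      then have "pi / 3 \<le> subspace_angle (column k A) (span (set xs))" by simp
      then show ?thesis
        using Az column_nonzero[OF A, of k]
        by (subst (asm) pi_third_le_subspace_angle_iff) auto
    qed simp
  qed
next
  assume rhs: ?rhs
  show "nearly_orthogonal (columns A)"
    unfolding nearly_orthogonal_def weakly_nearly_orthogonal_def
  proof (intro allI impI)
    fix bs :: "(real ^ 'n) list" and i
    assume bs: "distinct bs \<and> set bs = columns A" and i: "1 \<le> i \<and> i < length bs"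
    then have "bs ! i \<in> columns A" using nth_mem by blast
    then obtain k where k: "bs ! i = column k A" by (auto simp: columns_def)
    have "bs ! i \<notin> set (take i bs)"
      using bs i by (auto simp: in_set_conv_nth nth_eq_iff_index_eq)
    then have sub: "set (take i bs) \<subseteq> columns A - {column k A}"
      using bs set_take_subset[of i bs] k by auto
    have "bs ! 0 \<in> set (take i bs)"
      using i by (auto simp: in_set_conv_nth intro!: exI[of _ 0])
    moreover from this have "bs ! 0 \<noteq> 0"
      using sub column_nonzero[OF A] by (force simp: columns_def)
    ultimately have ne: "\<not> span (set (take i bs)) \<subseteq> {0}"
      using span_base by fastforce
    show "pi / 3 \<le> subspace_angle (bs ! i) (span (set (take i bs)))"
      unfolding k pi_third_le_subspace_angle_iff[OF ne column_nonzero[OF A]]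
    proof
      fix w assume "w \<in> span (set (take i bs))"
      then have "w \<in> (*v) A ` {z. z $ k = 0}"
        using span_mono[OF sub] span_other_columns[OF A, of k] by auto
      then show "2 * (column k A \<bullet> w) \<le> norm (column k A) * norm w"
        using rhs by auto
    qed
  qed
qed

section \<open>Minimal vectors in a nearly orthogonal basis\<close>

text \<open>Here \<open>(u - v)\<^sup>2 \<le> m\<^sup>2 - u * v \<le> 0\<close>. Geometrically, in a
  triangle with an angle of 60 degrees between sides of length at least \<open>m\<close>, the third
  side is at most \<open>m\<close> only in the equilateral case.\<close>

lemma sum_squares_diff_mult_le_imp_eq:
  fixes u v m :: real
  assumes "m \<le> u" "m \<le> v" "0 < m" "u\<^sup>2 + v\<^sup>2 - u * v \<le> m\<^sup>2"
  shows "u = m" "v = m"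
proof -
  have sq: "m * m \<le> u * v" using assms by (intro mult_mono) auto
  then have "(u - v)\<^sup>2 \<le> 0"
    using assms(4) by (simp add: power2_eq_square algebra_simps)
  then have "u = v" by simp
  then have "u\<^sup>2 \<le> m\<^sup>2" using assms(4) by (simp add: power2_eq_square)
  then have "u \<le> m" using assms(3) power2_le_imp_le by fastforce
  then show "u = m" "v = m" using \<open>u = v\<close> assms(1) by auto
qed

lemma matrix_vector_mult_minus: "A *v (- z) = - (A *v z)" for A :: "real ^ 'n::finite ^ 'm::finite"
  using matrix_vector_mult_scaleR[of A "-1" z] by simp

lemma integer_lattice_drop:
  fixes z :: "real ^ 'n::finite"
  assumes "z \<in> integer_lattice"
  shows "z - z $ k *\<^sub>R axis k 1 \<in> integer_lattice"
  using assms by (intro integer_lattice_closed) (auto simp: integer_lattice_def)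

text \<open>If \<open>y\<close> is nonzero, \<open>A *v z\<close> is the sum of
  \<open>A *v y\<close> and a multiple of column \<open>k\<close>, both of norm at least the
  minimum. Near orthogonality bounds their inner product by half the product of the norms, and the
  law of cosines leaves only the case of equality.\<close>

lemma nearly_orthogonal_minimal_vector:
  fixes A :: "real ^ 'n::finite ^ 'n"
  assumes A: "invertible A" and no: "nearly_orthogonal (columns A)"
    and z: "z \<in> integer_lattice" "norm (A *v z) = min_norm (lattice_of A)" "z $ k \<noteq> 0"
    and y: "y = z - z $ k *\<^sub>R axis k 1"
  shows "norm (column k A) = min_norm (lattice_of A)"
    and "y \<noteq> 0 \<Longrightarrow> norm (A *v y) = min_norm (lattice_of A)"
    and "y \<noteq> 0 \<Longrightarrow> 2 * \<bar>column k A \<bullet> (A *v y)\<bar> = (min_norm (lattice_of A))\<^sup>2"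
proof -
  let ?m = "min_norm (lattice_of A)"
  have L: "is_lattice (lattice_of A)" using A by (rule is_lattice_lattice_of)
  have m: "0 < ?m" by (rule min_norm_pos[OF L])
  have b: "?m \<le> norm (column k A)"
    by (intro min_norm_le[OF L] column_nonzero A) simp
  have "1 \<le> \<bar>z $ k\<bar>"
    using z by (intro Ints_nonzero_abs_ge1) (auto simp: integer_lattice_def)
  define v where "v = \<bar>z $ k\<bar> * norm (column k A)"
  have bv: "norm (column k A) \<le> v"
    using \<open>1 \<le> \<bar>z $ k\<bar>\<close> by (simp add: v_def mult_le_cancel_right1)
  have Az: "A *v z = A *v y + z $ k *\<^sub>R column k A"
    by (simp add: y column_eq_axis matrix_vector_mult_diff_distrib matrix_vector_mult_scaleR)
  have "norm (column k A) = ?m \<and> (y \<noteq> 0 \<longrightarrow> norm (A *v y) = ?m \<and> 2 * \<bar>column k A \<bullet> (A *v y)\<bar> = ?m\<^sup>2)"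
  proof (cases "y = 0")
    case True
    then have "v = ?m" using Az z(2) by (simp add: v_def)
    then show ?thesis using True b bv by simp
  next
    case False
    define u where "u = norm (A *v y)"
    have "A *v y \<noteq> 0" using False invertible_inj[OF A, of y 0] by simp
    moreover have "A *v y \<in> lattice_of A"
      unfolding y by (intro lattice_ofI integer_lattice_drop z)
    ultimately have u: "?m \<le> u" unfolding u_def by (intro min_norm_le[OF L])
    \<comment> \<open>Near orthogonality is applied to \<open>y\<close> and to \<open>- y\<close> to
      bound the absolute value of the inner product.\<close>
    have yk: "y $ k = 0" "(- y) $ k = 0" by (simp_all add: y)
    have half: "2 * \<bar>column k A \<bullet> (A *v y)\<bar> \<le> norm (column k A) * u"
      using no[unfolded nearly_orthogonal_columns_iff[OF A], rule_format, OF yk(1)]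
        no[unfolded nearly_orthogonal_columns_iff[OF A], rule_format, OF yk(2)]
      by (simp add: u_def abs_if matrix_vector_mult_minus)
    define d where "d = z $ k * (column k A \<bullet> (A *v y))"
    have d: "2 * \<bar>d\<bar> \<le> u * v"
      using mult_left_mono[OF half, of "\<bar>z $ k\<bar>"] by (simp add: d_def v_def abs_mult mult_ac)
    have "?m\<^sup>2 = u\<^sup>2 + 2 * d + v\<^sup>2"
      unfolding z(2)[symmetric] u_def v_def d_def Az
      using norm_sum_squared[of 1 "A *v y" "z $ k" "column k A"]
      by (simp add: power_mult_distrib inner_commute)
    moreover from this d have "u\<^sup>2 + v\<^sup>2 - u * v \<le> ?m\<^sup>2" by linarith
    then have uv: "u = ?m" "v = ?m"
      using sum_squares_diff_mult_le_imp_eq[OF u order_trans[OF b bv] m] by blast+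
    ultimately have "2 * d = - ?m\<^sup>2" by simp
    then have "2 * \<bar>d\<bar> = ?m\<^sup>2" using zero_le_power2[of ?m] by linarith
    moreover have bm: "norm (column k A) = ?m" using b bv uv by simp
    then have "\<bar>z $ k\<bar> = 1" using uv(2) m by (simp add: v_def)
    ultimately have "2 * \<bar>column k A \<bullet> (A *v y)\<bar> = ?m\<^sup>2"
      by (simp add: d_def abs_mult)
    then show ?thesis using bm uv(1) u_def by simp
  qed
  then show "norm (column k A) = ?m" "y \<noteq> 0 \<Longrightarrow> norm (A *v y) = ?m"
    "y \<noteq> 0 \<Longrightarrow> 2 * \<bar>column k A \<bullet> (A *v y)\<bar> = ?m\<^sup>2" by auto
qed

text \<open>
  Dropping the other coordinates one by one keeps the vector minimal, until only
  \<open>\<plusminus> b\<^sub>i \<plusminus> b\<^sub>j\<close> is left.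
\<close>

lemma nearly_orthogonal_minimal_pair:
  fixes A :: "real ^ 'n::finite ^ 'n"
  assumes A: "invertible A" and no: "nearly_orthogonal (columns A)" and ij: "i \<noteq> j"
    and z: "z \<in> integer_lattice" "norm (A *v z) = min_norm (lattice_of A)" "z $ i \<noteq> 0" "z $ j \<noteq> 0"
  shows "2 * \<bar>column i A \<bullet> column j A\<bar> = (min_norm (lattice_of A))\<^sup>2"
  using z
proof (induction "card {k. z $ k \<noteq> 0}" arbitrary: z rule: less_induct)
  case less
  note min = nearly_orthogonal_minimal_vector[OF A no less.prems(1,2)]
  show ?case
  proof (cases "\<exists>k. k \<noteq> i \<and> k \<noteq> j \<and> z $ k \<noteq> 0")
    case True
    then obtain k where k: "k \<noteq> i" "k \<noteq> j" "z $ k \<noteq> 0" by blast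
    let ?y = "z - z $ k *\<^sub>R axis k 1"
    have y: "?y $ i \<noteq> 0" "?y $ j \<noteq> 0" using k less.prems by (auto simp: axis_def)
    then have "?y \<noteq> 0" by (metis zero_index)
    then have "norm (A *v ?y) = min_norm (lattice_of A)" using min(2)[OF k(3) refl] by blast
    moreover have "{l. ?y $ l \<noteq> 0} \<subset> {l. z $ l \<noteq> 0}"
      using k(3) by (auto simp: axis_def)
    ultimately show ?thesis
      using less.hyps[of ?y] y integer_lattice_drop[OF less.prems(1)] psubset_card_mono[of "{l. z $ l \<noteq> 0}"]
      by simp
  next
    case False
    let ?y = "z - z $ i *\<^sub>R axis i 1"
    have y: "?y = z $ j *\<^sub>R axis j 1"
      using False ij by (auto simp: vec_eq_iff axis_def)
    have Ay: "A *v ?y = z $ j *\<^sub>R column j A"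
      unfolding y by (simp add: matrix_vector_mult_scaleR column_eq_axis)
    have "?y \<noteq> 0" unfolding y using less.prems(4) by (simp add: axis_eq_0_iff)
    then have 1: "norm (A *v ?y) = min_norm (lattice_of A)"
      and 2: "2 * \<bar>column i A \<bullet> (A *v ?y)\<bar> = (min_norm (lattice_of A))\<^sup>2"
      using min(2,3)[OF less.prems(3) refl] by blast+
    have "norm (column j A) = min_norm (lattice_of A)" by (rule min(1)[OF less.prems(4) refl])
    moreover have "0 < min_norm (lattice_of A)"
      by (intro min_norm_pos is_lattice_lattice_of A)
    \<comment> \<open>Column \<open>j\<close> and its multiple by \<open>z $ j\<close> both have
      minimal norm.\<close>
    ultimately have "\<bar>z $ j\<bar> = 1" using 1 by (simp add: Ay)
    then show ?thesis using 2 by (simp add: Ay abs_mult)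
  qed
qed

text \<open>Otherwise all minimal vectors would lie in the hyperplane \<open>z $ k = 0\<close> and
  could not span.\<close>

lemma well_rounded_coordinate:
  fixes A :: "real ^ 'n::finite ^ 'n"
  assumes A: "invertible A" and wr: "well_rounded (lattice_of A)"
  obtains z where "z \<in> integer_lattice" "norm (A *v z) = min_norm (lattice_of A)" "z $ k \<noteq> 0"
proof (rule ccontr)
  assume *: "\<not> thesis"
  note wit = that
  have "min_vectors (lattice_of A) \<subseteq> (*v) A ` {z. z $ k = 0}"
    using * wit by (force simp: min_vectors_def lattice_of_def)
  moreover have "subspace ((*v) A ` {z. z $ k = 0})"
    by (rule subspace_matrix_image) (simp add: subspace_def)
  ultimately have "span (min_vectors (lattice_of A)) \<subseteq> (*v) A ` {z. z $ k = 0}"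
    by (rule span_minimal)
  then have "A *v axis k 1 \<in> (*v) A ` {z. z $ k = 0}"
    using wr span_lattice_of[OF A] by (auto simp: well_rounded_def)
  then show False using invertible_inj[OF A] by auto
qed

lemma three_distinct:
  assumes "3 \<le> CARD('n::finite)"
  obtains i j k :: "'n::finite" where "i \<noteq> j" "j \<noteq> k" "i \<noteq> k"
proof -
  obtain S :: "'n set" where "card S = 3"
    using obtain_subset_with_card_n[OF assms] by metis
  then show thesis using that by (auto simp: card_3_iff)
qed

text \<open>
  Three unit vectors with all inner products \<open>\<plusminus> 1/2\<close> are linearly dependent
  or violate near orthogonality.
\<close>

lemma nearly_orthogonal_wr_pair:
  fixes A :: "real ^ 'n::finite ^ 'n"
  assumes n: "3 \<le> CARD('n)" and A: "invertible A" and no: "nearly_orthogonal (columns A)"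
    and wr: "well_rounded (lattice_of A)"
  obtains i j where "i \<noteq> j" "\<And>z. z \<in> integer_lattice \<Longrightarrow> norm (A *v z) = min_norm (lattice_of A) \<Longrightarrow>
    z $ i = 0 \<or> z $ j = 0"
proof (rule ccontr)
  assume *: "\<not> thesis"
  note wit = that
  let ?m = "min_norm (lattice_of A)"
  let ?b = "\<lambda>i. column i A"
  have m: "0 < ?m" by (intro min_norm_pos is_lattice_lattice_of A)
  have pair: "2 * \<bar>?b i \<bullet> ?b j\<bar> = ?m\<^sup>2" if "i \<noteq> j" for i j
  proof -
    obtain z where "z \<in> integer_lattice" "norm (A *v z) = ?m" "z $ i \<noteq> 0" "z $ j \<noteq> 0"
      using * wit \<open>i \<noteq> j\<close> by blast
    then show ?thesis using nearly_orthogonal_minimal_pair[OF A no \<open>i \<noteq> j\<close>] by blast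
  qed
  have b: "norm (?b k) = ?m" for k
    using well_rounded_coordinate[OF A wr, of k] nearly_orthogonal_minimal_vector(1)[OF A no]
    by metis
  obtain i j k :: 'n where ijk: "i \<noteq> j" "j \<noteq> k" "i \<noteq> k"
    by (rule three_distinct[OF n])
  \<comment> \<open>The signs make both contributions to the inner product of column
    \<open>k\<close> with \<open>A *v ?z\<close> equal to \<open>?m\<^sup>2 / 2\<close>. Near
    orthogonality then forces norm at least \<open>2 * ?m\<close> on \<open>A *v ?z\<close>, while
    expanding its square gives at most \<open>3 * ?m\<^sup>2\<close>.\<close>
  define e where "e = sgn (?b k \<bullet> ?b i)"
  define f where "f = sgn (?b k \<bullet> ?b j)"
  have ne: "?b k \<bullet> ?b i \<noteq> 0" "?b k \<bullet> ?b j \<noteq> 0"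
    using pair[of k i] pair[of k j] ijk m by auto
  then have ef: "e\<^sup>2 = 1" "f\<^sup>2 = 1" "\<bar>e\<bar> = 1" "\<bar>f\<bar> = 1"
    by (auto simp: e_def f_def sgn_if)
  let ?z = "e *\<^sub>R axis i 1 + f *\<^sub>R axis j 1 :: real ^ 'n"
  have Az: "A *v ?z = e *\<^sub>R ?b i + f *\<^sub>R ?b j"
    by (simp add: matrix_vector_right_distrib matrix_vector_mult_scaleR column_eq_axis)
  have "?z $ k = 0" using ijk by (simp add: axis_def)
  then have "2 * (?b k \<bullet> (A *v ?z)) \<le> ?m * norm (A *v ?z)"
    using no[unfolded nearly_orthogonal_columns_iff[OF A]] b by metis
  moreover have "2 * (?b k \<bullet> (A *v ?z)) = 2 * \<bar>?b k \<bullet> ?b i\<bar> + 2 * \<bar>?b k \<bullet> ?b j\<bar>"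
    unfolding Az by (simp add: inner_add_right e_def f_def sgn_if)
  then have "2 * (?b k \<bullet> (A *v ?z)) = 2 * ?m\<^sup>2"
    using pair[of k i] pair[of k j] ijk by simp
  ultimately have "2 * ?m \<le> norm (A *v ?z)"
    using m by (simp add: power2_eq_square)
  then have "(2 * ?m)\<^sup>2 \<le> (norm (A *v ?z))\<^sup>2" using m by (intro power_mono) auto
  moreover have "(norm (A *v ?z))\<^sup>2 = 2 * ?m\<^sup>2 + 2 * (e * f * (?b i \<bullet> ?b j))"
  proof -
    have "(norm (A *v ?z))\<^sup>2 = e\<^sup>2 * (norm (?b i))\<^sup>2 + f\<^sup>2 * (norm (?b j))\<^sup>2 + 2 * (e * f * (?b i \<bullet> ?b j))"
      unfolding Az by (rule norm_sum_squared)
    then show ?thesis by (simp add: b ef)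
  qed
  moreover have "2 * (e * f * (?b i \<bullet> ?b j)) \<le> ?m\<^sup>2"
  proof -
    have "e * f * (?b i \<bullet> ?b j) \<le> \<bar>e * f * (?b i \<bullet> ?b j)\<bar>" by (rule abs_ge_self)
    then show ?thesis using pair[OF ijk(1)] ef by (simp add: abs_mult)
  qed
  moreover have "0 < ?m\<^sup>2" using m by simp
  ultimately show False by (simp add: power_mult_distrib)
qed

section \<open>Similarity, and extreme lattices of rank at least three\<close>

lemma min_norm_similar:
  fixes A B :: "real ^ 'n::finite ^ 'n"
  assumes A: "invertible A" and B: "invertible B" and "0 < \<alpha>"
    and eq: "\<And>z. norm (B *v z) = \<alpha> * norm (A *v z)"
  shows "min_norm (lattice_of B) = \<alpha> * min_norm (lattice_of A)"
proof -
  obtain z where z: "z \<in> integer_lattice" "A *v z \<noteq> 0" "norm (A *v z) = min_norm (lattice_of A)"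
    using min_norm_attained(1)[OF is_lattice_lattice_of[OF A]] by (auto simp: lattice_of_def)
  have "min_norm (lattice_of B) = norm (B *v z)"
  proof (rule min_norm_eqI)
    show "is_lattice (lattice_of B)" using B by (rule is_lattice_lattice_of)
    show "B *v z \<in> lattice_of B" using z(1) by (rule lattice_ofI)
    show "B *v z \<noteq> 0" using z(2) eq[of z] \<open>0 < \<alpha>\<close> by auto
    fix y assume y: "y \<in> lattice_of B" "y \<noteq> 0"
    then obtain x where x: "x \<in> integer_lattice" "y = B *v x" by (auto simp: lattice_of_def)
    then have "A *v x \<noteq> 0" using y invertible_inj[OF A, of x 0] by auto
    then have "min_norm (lattice_of A) \<le> norm (A *v x)"
      using x by (intro min_norm_le is_lattice_lattice_of A lattice_ofI)
    then show "norm (B *v z) \<le> norm y" using \<open>0 < \<alpha>\<close> by (simp add: eq x z(3))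
  qed
  then show ?thesis by (simp add: eq z(3))
qed

lemma norm_orthogonal_matrix:
  fixes U :: "real ^ 'n::finite ^ 'n"
  assumes "orthogonal_matrix U"
  shows "norm (U *v x) = norm x"
proof -
  have "orthogonal_transformation ((*v) U)"
    using assms by (simp add: orthogonal_transformation_matrix)
  then show ?thesis by (rule orthogonal_transformation_norm)
qed

text \<open>\<open>W_star\<close> consists of classes, so the nearly orthogonal basis
  \<open>A\<close> belongs to some \<open>M\<close> similar to \<open>L\<close>. The similarity
  carries \<open>A\<close> to a basis \<open>C\<close> of \<open>L\<close> for which minimal vectors
  have the same coordinates. Two coordinates that are never both nonzero then contradict extremality
  of \<open>L\<close>.\<close>

lemma W_star_not_extreme:
  fixes L :: "(real ^ 'n::finite) set"
  assumes n: "3 \<le> CARD('n)" and ext: "extreme L" and W: "similarity_class L \<in> W_star"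
  shows False
proof -
  obtain M B where M: "similarity_class L = similarity_class M" "well_rounded M"
    "lattice_basis B M" "nearly_orthogonal B"
    using W by (auto simp: W_star_def)
  then obtain A where A: "invertible A" "M = lattice_of A" "B = columns A"
    by (auto simp: lattice_basis_def basis_matrix_def)
  obtain i j where ij: "i \<noteq> j" "\<And>z. z \<in> integer_lattice \<Longrightarrow>
      norm (A *v z) = min_norm (lattice_of A) \<Longrightarrow> z $ i = 0 \<or> z $ j = 0"
    using nearly_orthogonal_wr_pair[OF n A(1)] M A by metis
  have "is_lattice L" using ext by (simp add: extreme_def)
  then have "similar_lattices M L"
    using M(1) similarity_class_eq_iff[of L M] is_lattice_lattice_of[OF A(1)] similar_lattices_sym
    by (auto simp: A(2))
  then obtain \<alpha> U where U: "\<alpha> > 0" "orthogonal_matrix U" "L = (\<lambda>x. \<alpha> *\<^sub>R (U *v x)) ` M"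
    by (auto simp: similar_lattices_def)
  define C where "C = \<alpha> *\<^sub>R (U ** A)"
  have Cz: "C *v z = \<alpha> *\<^sub>R (U *v (A *v z))" for z
    by (simp add: C_def matrix_vector_mul_assoc flip: scaleR_matrix_vector_assoc)
  then have L: "L = lattice_of C" by (simp add: U(3) A(2) lattice_of_def image_image)
  have normC: "norm (C *v z) = \<alpha> * norm (A *v z)" for z
    using U by (simp add: Cz norm_orthogonal_matrix)
  have "z = 0" if "C *v z = 0" for z
    using normC[of z] that U(1) invertible_inj[OF A(1), of z 0] by simp
  then have C: "invertible C"
    by (simp add: invertible_left_inverse matrix_left_invertible_ker)
  obtain z where z: "z \<in> integer_lattice" "norm (C *v z) = min_norm (lattice_of C)"
    "z $ i \<noteq> 0" "z $ j \<noteq> 0"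
    using extreme_minimal_vector[OF _ C ij(1)] ext L by metis
  then have "norm (A *v z) = min_norm (lattice_of A)"
    using min_norm_similar[OF A(1) C U(1) normC] U(1) by (simp add: normC)
  then show False using ij(2) z by blast
qed

section \<open>The hexagonal lattice\<close>

lemma matrix_vector_mult_2: "A *v z = z $ 1 *\<^sub>R column 1 A + z $ 2 *\<^sub>R column 2 A"
  for A :: "real ^ 2 ^ 2"
  by (simp add: matrix_mult_sum sum_2 scalar_mult_eq_scaleR)

text \<open>The Gram determinant of two vectors, by Lagrange's identity.\<close>

lemma det_2_squared:
  fixes A :: "real ^ 2 ^ 2"
  shows "(det A)\<^sup>2 = (norm (column 1 A))\<^sup>2 * (norm (column 2 A))\<^sup>2 - (column 1 A \<bullet> column 2 A)\<^sup>2"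
  unfolding power2_norm_eq_inner
  by (simp add: det_2 inner_vec_def sum_2 column_def power2_eq_square algebra_simps)

text \<open>A minimal vector is primitive, so Bezout's identity extends it to a basis. Shifting the
  second vector by a multiple of the first and adjusting its sign gives the bounds on the inner
  product.\<close>

lemma reduced_basis_2:
  fixes L :: "(real ^ 2) set"
  assumes "is_lattice L"
  obtains A where "invertible A" "L = lattice_of A" "norm (column 1 A) = min_norm L"
    "min_norm L \<le> norm (column 2 A)"
    "0 \<le> column 1 A \<bullet> column 2 A" "2 * (column 1 A \<bullet> column 2 A) \<le> (min_norm L)\<^sup>2"
proof -
  let ?m = "min_norm L"
  have m: "0 < ?m" using assms by (rule min_norm_pos)
  obtain B where B: "invertible B" "L = lattice_of B"
    using assms by (auto simp: is_lattice_def basis_matrix_def)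
  obtain z where z: "z \<in> integer_lattice" "norm (B *v z) = ?m" "B *v z \<noteq> 0"
    using min_norm_attained(1)[OF assms] by (auto simp: B(2) lattice_of_def)
  have "z $ 1 \<in> \<int>" "z $ 2 \<in> \<int>" using z(1) by (auto simp: integer_lattice_def)
  then obtain a b where ab: "z $ 1 = of_int a" "z $ 2 = of_int b"
    by (auto elim!: Ints_cases)
  \<comment> \<open>Dividing the coordinates by a larger common divisor would give a lattice vector
    shorter than the minimum.\<close>
  have "gcd a b = 1"
  proof -
    let ?g = "gcd a b"
    have "a \<noteq> 0 \<or> b \<noteq> 0" using z(3) ab by (auto simp: matrix_vector_mult_2)
    then have g: "0 < ?g" by simp
    define y where "y = (1 / of_int ?g) *\<^sub>R z"
    have "of_int a / of_int ?g = (of_int (a div ?g) :: real)"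
      "of_int b / of_int ?g = (of_int (b div ?g) :: real)"
      by (auto simp: real_of_int_div)
    then have "y \<in> integer_lattice"
      by (auto simp: integer_lattice_def y_def forall_2 ab)
    then have "B *v y \<in> L" unfolding B(2) by (rule lattice_ofI)
    moreover have By: "B *v y = (1 / of_int ?g) *\<^sub>R (B *v z)"
      by (simp add: y_def matrix_vector_mult_scaleR)
    ultimately have "?m \<le> norm (B *v y)"
      using z(3) g by (intro min_norm_le[OF assms]) auto
    also have "\<dots> = ?m / of_int ?g" using g by (simp add: By z(2))
    finally have "of_int ?g \<le> (1 :: real)" using m g by (simp add: field_simps)
    then show ?thesis using g by linarith
  qed
  then obtain r s where rs: "r * a + s * b = 1"
    using bezout_int[of a b] by auto
  \<comment> \<open>The matrix with columns \<open>z\<close> and \<open>w\<close> has determinant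
    \<open>r * a + s * b = 1\<close>.\<close>
  define w :: "real ^ 2" where "w = vector [- of_int s, of_int r]"
  have w: "w \<in> integer_lattice"
    by (auto simp: w_def integer_lattice_def forall_2)
  define u where "u = B *v z"
  have uu: "u \<bullet> u = ?m\<^sup>2" by (simp add: u_def z(2) flip: power2_norm_eq_inner)
  \<comment> \<open>Rounding to the nearest integer leaves a projection coefficient of at most
    \<open>1 / 2\<close> in absolute value.\<close>
  define k :: real where "k = - of_int (round ((u \<bullet> (B *v w)) / ?m\<^sup>2))"
  have k: "2 * \<bar>u \<bullet> (B *v (w + k *\<^sub>R z))\<bar> \<le> ?m\<^sup>2"
  proof -
    let ?x = "(u \<bullet> (B *v w)) / ?m\<^sup>2"
    have "u \<bullet> (B *v (w + k *\<^sub>R z)) = (?x + k) * ?m\<^sup>2"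
      using m uu by (simp add: u_def matrix_vector_right_distrib matrix_vector_mult_scaleR
          inner_add_right field_simps)
    moreover have "\<bar>?x + k\<bar> \<le> 1 / 2"
      using of_int_round_abs_le[of ?x] by (simp add: k_def abs_minus_commute)
    then have "\<bar>?x + k\<bar> * ?m\<^sup>2 \<le> 1 / 2 * ?m\<^sup>2" by (intro mult_right_mono) auto
    ultimately show ?thesis by (simp add: abs_mult)
  qed
  define e :: real where "e = (if 0 \<le> u \<bullet> (B *v (w + k *\<^sub>R z)) then 1 else - 1)"
  define y where "y = e *\<^sub>R (w + k *\<^sub>R z)"
  have ey: "\<bar>e\<bar> = 1" by (simp add: e_def)
  have y: "y \<in> integer_lattice"
    unfolding y_def using w z(1) by (intro integer_lattice_closed) (auto simp: e_def k_def)
  have uy: "u \<bullet> (B *v y) = \<bar>u \<bullet> (B *v (w + k *\<^sub>R z))\<bar>"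
    unfolding y_def matrix_vector_mult_scaleR by (simp add: e_def)
  define U :: "real ^ 2 ^ 2" where "U = (\<chi> i j. if j = 1 then z $ i else y $ i)"
  define A where "A = B ** U"
  have col: "column 1 A = u" "column 2 A = B *v y"
    by (simp_all add: A_def U_def column_def matrix_matrix_mult_def matrix_vector_mult_def u_def vec_eq_iff)
  have "det U = e * (of_int (r * a + s * b))"
    by (simp add: det_2 U_def y_def w_def ab algebra_simps)
  then have "\<bar>det U\<bar> = 1" using rs ey by simp
  then have det: "\<bar>det A\<bar> = \<bar>det B\<bar>" by (simp add: A_def det_mul abs_mult)
  have A: "invertible A" using det B(1) by (auto simp: invertible_det_nz)
  have colL: "column i A \<in> lattice_of B" for i
    using exhaust_2[of i] z(1) y by (auto simp: col u_def lattice_ofI)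
  have "lattice_of A = lattice_of B"
    by (rule lattice_of_eqI[OF B(1) colL det])
  moreover have "?m \<le> norm (column 2 A)"
    using colL[of 2] column_nonzero[OF A, of 2] by (intro min_norm_le[OF assms]) (auto simp: B(2))
  ultimately show thesis
    using that[of A] A k by (auto simp: B(2) col uy) (auto simp: u_def z(2) B(2)[symmetric])
qed

text \<open>By the Gram determinant, \<open>(det A)\<^sup>2\<close> is at least
  \<open>m ^ 4 - m ^ 4 / 4\<close>.\<close>

lemma reduced_basis_2_det:
  fixes A :: "real ^ 2 ^ 2"
  assumes "norm (column 1 A) = m" "m \<le> norm (column 2 A)" "0 \<le> m"
    "0 \<le> column 1 A \<bullet> column 2 A" "2 * (column 1 A \<bullet> column 2 A) \<le> m\<^sup>2"
  shows "sqrt 3 / 2 * m\<^sup>2 \<le> \<bar>det A\<bar>"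
proof -
  have "m\<^sup>2 * m\<^sup>2 \<le> m\<^sup>2 * (norm (column 2 A))\<^sup>2"
    using assms by (intro mult_left_mono power_mono) auto
  moreover have "(2 * (column 1 A \<bullet> column 2 A))\<^sup>2 \<le> (m\<^sup>2)\<^sup>2"
    using assms by (intro power_mono) auto
  ultimately have "3 / 4 * (m\<^sup>2)\<^sup>2 \<le> (det A)\<^sup>2"
    unfolding det_2_squared assms(1) by (simp add: power2_eq_square)
  then have "(sqrt 3 / 2 * m\<^sup>2)\<^sup>2 \<le> \<bar>det A\<bar>\<^sup>2"
    by (simp add: power_mult_distrib power_divide)
  then show ?thesis by (rule power2_le_imp_le) simp
qed

section \<open>Optimality of the hexagonal lattice\<close>

definition hexagonal_basis :: "real ^ 2 ^ 2" where
  "hexagonal_basis = vector [vector [1, 1 / 2], vector [0, sqrt 3 / 2]]"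

lemma hexagonal_lattice_eq: "hexagonal_lattice = lattice_of hexagonal_basis"
  by (simp add: hexagonal_lattice_def hexagonal_basis_def)

lemma det_hexagonal_basis: "det hexagonal_basis = sqrt 3 / 2"
  by (simp add: det_2 hexagonal_basis_def)

lemma invertible_hexagonal_basis: "invertible hexagonal_basis"
  by (simp add: invertible_det_nz det_hexagonal_basis)

lemma inner_hexagonal_basis:
  "column i hexagonal_basis \<bullet> column j hexagonal_basis = (if i = j then 1 else 1 / 2)"
  using exhaust_2[of i] exhaust_2[of j]
  by (auto simp: hexagonal_basis_def column_def inner_vec_def sum_2)

lemma norm_hexagonal_basis: "norm (column i hexagonal_basis) = 1"
  by (simp add: norm_eq_sqrt_inner inner_hexagonal_basis)

lemma min_norm_hexagonal_lattice: "min_norm (lattice_of hexagonal_basis) = 1"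
proof -
  have "min_norm (lattice_of hexagonal_basis) = norm (column 1 hexagonal_basis)"
  proof (rule min_norm_eqI)
    show "is_lattice (lattice_of hexagonal_basis)"
      by (rule is_lattice_lattice_of[OF invertible_hexagonal_basis])
    show "column 1 hexagonal_basis \<noteq> 0" by (rule column_nonzero[OF invertible_hexagonal_basis])
    fix y assume "y \<in> lattice_of hexagonal_basis" "y \<noteq> 0"
    then obtain z where z: "z \<in> integer_lattice" "y = hexagonal_basis *v z" by (auto simp: lattice_of_def)
    have "z $ 1 \<in> \<int>" "z $ 2 \<in> \<int>" using z(1) by (auto simp: integer_lattice_def)
    then obtain a b where ab: "z $ 1 = of_int a" "z $ 2 = of_int b"
      by (auto elim!: Ints_cases)
    have "a \<noteq> 0 \<or> b \<noteq> 0" using \<open>y \<noteq> 0\<close> z(2) ab by (auto simp: matrix_vector_mult_2)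
    \<comment> \<open>This is four times \<open>a\<^sup>2 + b\<^sup>2 + a * b\<close>, so that
      integral form is positive and hence at least 1.\<close>
    have "0 < (2 * a + b)\<^sup>2 + 3 * b\<^sup>2"
    proof (cases "b = 0")
      case True
      then show ?thesis using \<open>a \<noteq> 0 \<or> b \<noteq> 0\<close> by simp
    qed (simp add: add_nonneg_pos)
    then have "1 \<le> a\<^sup>2 + b\<^sup>2 + a * b" by (simp add: power2_eq_square algebra_simps)
    then have "(1 :: real) \<le> of_int (a\<^sup>2 + b\<^sup>2 + a * b)" by linarith
    also have "\<dots> = (norm y)\<^sup>2"
      unfolding z(2) matrix_vector_mult_2 norm_sum_squared
      by (simp add: norm_hexagonal_basis inner_hexagonal_basis ab)
    finally have "1 \<le> norm y" by (simp add: power2_nonneg_ge_1_iff)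
    then show "norm (column 1 hexagonal_basis) \<le> norm y" by (simp add: norm_hexagonal_basis)
  qed auto
  then show ?thesis by (simp add: norm_hexagonal_basis)
qed

text \<open>The determinant bound for reduced bases holds with equality for the hexagonal
  basis.\<close>

lemma hexagonal_lattice_densest:
  fixes L :: "(real ^ 2) set"
  assumes "is_lattice L"
  shows "packing_density L \<le> packing_density hexagonal_lattice"
proof -
  obtain A where A: "invertible A" "L = lattice_of A" "norm (column 1 A) = min_norm L"
    "min_norm L \<le> norm (column 2 A)"
    "0 \<le> column 1 A \<bullet> column 2 A" "2 * (column 1 A \<bullet> column 2 A) \<le> (min_norm L)\<^sup>2"
    by (rule reduced_basis_2[OF assms])
  have "sqrt 3 / 2 * (min_norm L)\<^sup>2 \<le> \<bar>det A\<bar>"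
    using min_norm_pos[OF assms] by (intro reduced_basis_2_det A) auto
  moreover have "0 < \<bar>det A\<bar>" using A(1) by (simp add: invertible_det_nz)
  ultimately have "(min_norm L)\<^sup>2 / \<bar>det A\<bar> \<le> 1 / (sqrt 3 / 2)"
    by (simp add: field_simps)
  then show ?thesis
    unfolding A(2) hexagonal_lattice_eq packing_density_le_iff[OF A(1) invertible_hexagonal_basis]
    by (simp add: A(2)[symmetric] min_norm_hexagonal_lattice det_hexagonal_basis)
qed

text \<open>A global maximum of the density is extreme, with the whole space of lattices as the open
  set.\<close>

lemma extreme_hexagonal_lattice: "extreme hexagonal_lattice"
proof -
  have "lattice_of ` {A :: real ^ 2 ^ 2. invertible A} = Collect is_lattice"
    by (auto simp: is_lattice_def basis_matrix_def)
  then have "topspace (lattice_topology :: (real ^ 2) set topology) = Collect is_lattice"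
    using quotient_imp_surjective_map[OF quotient_map_lattice_of[where 'n = 2]] by simp
  then have "openin lattice_topology (Collect is_lattice :: (real ^ 2) set set)"
    by (metis openin_topspace)
  moreover have "is_lattice hexagonal_lattice"
    unfolding hexagonal_lattice_eq by (rule is_lattice_lattice_of[OF invertible_hexagonal_basis])
  ultimately show ?thesis
    unfolding extreme_def using hexagonal_lattice_densest by blast
qed

text \<open>Extremality yields a minimal vector that involves both members of a reduced basis. This
  forces equality in the reduction inequalities, so the Gram matrix is a multiple of the hexagonal
  one.\<close>

lemma extreme_2_imp_hexagonal:
  fixes L :: "(real ^ 2) set"
  assumes ext: "extreme L"
  shows "similar_lattices hexagonal_lattice L"
proof -
  have L: "is_lattice L" using ext by (simp add: extreme_def)
  let ?m = "min_norm L"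
  have m: "0 < ?m" by (rule min_norm_pos[OF L])
  obtain A where A: "invertible A" "L = lattice_of A" "norm (column 1 A) = ?m"
    "?m \<le> norm (column 2 A)"
    "0 \<le> column 1 A \<bullet> column 2 A" "2 * (column 1 A \<bullet> column 2 A) \<le> ?m\<^sup>2"
    by (rule reduced_basis_2[OF L])
  obtain z where z: "z \<in> integer_lattice" "norm (A *v z) = ?m" "z $ 1 \<noteq> 0" "z $ 2 \<noteq> 0"
    using extreme_minimal_vector[of A 1 2] ext A(1,2) by auto
  define x where "x = \<bar>z $ 1\<bar>"
  define y where "y = \<bar>z $ 2\<bar>"
  define b where "b = column 1 A \<bullet> column 2 A"
  define c where "c = (norm (column 2 A))\<^sup>2"
  have xy: "1 \<le> x" "1 \<le> y"
    using z unfolding x_def y_def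
    by (auto intro!: Ints_nonzero_abs_ge1 simp: integer_lattice_def)
  have c: "?m\<^sup>2 \<le> c" unfolding c_def using A(4) m by (intro power_mono) auto
  have xy1: "1 \<le> x * y" using mult_mono[OF xy] xy by simp
  have y1: "1 \<le> y\<^sup>2" using xy(2) by simp
  have "(norm (A *v z))\<^sup>2 = (z $ 1)\<^sup>2 * ?m\<^sup>2 + (z $ 2)\<^sup>2 * c + 2 * (z $ 1 * z $ 2 * b)"
    unfolding matrix_vector_mult_2 norm_sum_squared by (simp add: A(3) b_def c_def)
  then have "?m\<^sup>2 = (z $ 1)\<^sup>2 * ?m\<^sup>2 + (z $ 2)\<^sup>2 * c + 2 * (z $ 1 * z $ 2 * b)"
    unfolding z(2) .
  moreover have "(z $ 1)\<^sup>2 = x\<^sup>2" "(z $ 2)\<^sup>2 = y\<^sup>2" by (simp_all add: x_def y_def)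
  moreover have "- (x * y) * b \<le> z $ 1 * z $ 2 * b"
    using A(5) abs_ge_minus_self[of "z $ 1 * z $ 2"]
    by (intro mult_right_mono) (simp_all add: x_def y_def b_def abs_mult)
  ultimately have "x\<^sup>2 * ?m\<^sup>2 + y\<^sup>2 * c - 2 * (x * y * b) \<le> ?m\<^sup>2" by simp
  \<comment> \<open>The previous inequality regrouped into four nonnegative terms. The last two
    vanish, and since \<open>x * y\<close> and \<open>y\<^sup>2\<close> are at least 1, their
    remaining factors vanish too.\<close>
  then have "(x - y)\<^sup>2 * ?m\<^sup>2 + (x * y - 1) * ?m\<^sup>2 + x * y * (?m\<^sup>2 - 2 * b) + y\<^sup>2 * (c - ?m\<^sup>2) \<le> 0"
    by (simp add: power2_eq_square algebra_simps)
  moreover have "0 \<le> (x - y)\<^sup>2 * ?m\<^sup>2" "0 \<le> (x * y - 1) * ?m\<^sup>2" using xy1 by simp_all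
  moreover have "1 * (?m\<^sup>2 - 2 * b) \<le> x * y * (?m\<^sup>2 - 2 * b)" "1 * (c - ?m\<^sup>2) \<le> y\<^sup>2 * (c - ?m\<^sup>2)"
    using xy1 y1 c A(6) by (intro mult_right_mono; simp add: b_def)+
  moreover have "r = 0 \<and> s = 0"
    if "p + q + r' + s' \<le> 0" "0 \<le> p" "0 \<le> q" "1 * r \<le> r'" "1 * s \<le> s'" "0 \<le> r" "0 \<le> s"
    for p q r s r' s' :: real
    using that by simp
  ultimately have "?m\<^sup>2 - 2 * b = 0 \<and> c - ?m\<^sup>2 = 0"
    using c A(6)[folded b_def] by (metis diff_ge_0_iff_ge)
  then have eq: "2 * b = ?m\<^sup>2" "c = ?m\<^sup>2" by simp_all
  have "column i A \<bullet> column j A = (if i = j then ?m\<^sup>2 else ?m\<^sup>2 / 2)" for i j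
    using exhaust_2[of i] exhaust_2[of j] eq A(3)
    by (auto simp: b_def c_def inner_commute simp flip: power2_norm_eq_inner)
  then have gram: "transpose A ** A = ?m\<^sup>2 *\<^sub>R (transpose hexagonal_basis ** hexagonal_basis)"
    by (simp add: vec_eq_iff gram_component inner_hexagonal_basis)
  show ?thesis
    using lattice_of_similar[OF invertible_hexagonal_basis A(1) m gram]
    by (simp add: hexagonal_lattice_eq A(2)[symmetric])
qed

section \<open>Membership in \<open>W_star\<close> and the conclusion\<close>

lemma W_starI:
  fixes A :: "real ^ 'n::finite ^ 'n"
  assumes "invertible A" "nearly_orthogonal (columns A)"
    "\<And>k. norm (column k A) = min_norm (lattice_of A)"
  shows "similarity_class (lattice_of A) \<in> W_star"
  unfolding W_star_def lattice_basis_def basis_matrix_def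
  using assms well_roundedI[OF assms(1,3)] by blast

lemma hexagonal_lattice_in_W_star: "similarity_class hexagonal_lattice \<in> W_star"
  unfolding hexagonal_lattice_eq
proof (rule W_starI[OF invertible_hexagonal_basis])
  \<comment> \<open>With one coordinate zero and inner product \<open>1 / 2\<close> between the
    columns, the angle condition only says, up to a factor, that the other coordinate is at most its
    absolute value.\<close>
  have "z $ 1 * 2 \<le> 2 * \<bar>z $ 1\<bar>" for z :: "real ^ 2" by simp
  then show "nearly_orthogonal (columns hexagonal_basis)"
    unfolding nearly_orthogonal_columns_iff[OF invertible_hexagonal_basis]
    by (auto simp: forall_2 matrix_vector_mult_2 inner_hexagonal_basis norm_hexagonal_basis)
  show "norm (column k hexagonal_basis) = min_norm (lattice_of hexagonal_basis)" for k
    by (simp add: norm_hexagonal_basis min_norm_hexagonal_lattice)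
qed

lemma integer_lattice_in_W_star:
  "similarity_class (integer_lattice :: (real ^ 'n::finite) set) \<in> W_star"
proof -
  let ?I = "mat 1 :: real ^ 'n ^ 'n"
  have col: "column k ?I = axis k 1" for k by (simp add: column_eq_axis)
  have "nearly_orthogonal (columns ?I)"
    unfolding nearly_orthogonal_columns_iff[OF invertible_mat_1] col
    by (simp add: inner_axis')
  then show ?thesis
    using W_starI[OF invertible_mat_1, where 'n = 'n]
    by (auto simp: lattice_of_mat_1 min_norm_integer_lattice col)
qed

theorem corollary1p2:
  shows "(CARD('n::finite) \<ge> 3 \<longrightarrow>
            \<not> (\<exists>L :: (real ^ 'n) set. extreme L \<and> similarity_class L \<in> W_star)) \<and>
         (extreme hexagonal_lattice \<and>
            (\<forall>L :: (real ^ 2) set. extreme L \<longrightarrow> similar_lattices hexagonal_lattice L) \<and>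
            similarity_class hexagonal_lattice \<in> W_star) \<and>
         (CARD('n) \<ge> 2 \<longrightarrow>
            is_arg_min packing_density well_rounded (integer_lattice :: (real ^ 'n) set) \<and>
            (\<forall>L :: (real ^ 'n) set. is_arg_min packing_density well_rounded L \<longrightarrow>
               similar_lattices integer_lattice L) \<and>
            similarity_class (integer_lattice :: (real ^ 'n) set) \<in> W_star)"
proof -
  have "is_arg_min packing_density well_rounded (integer_lattice :: (real ^ 'n) set)"
    using well_rounded_packing_density(1)
    by (fastforce simp: is_arg_min_def well_rounded_integer_lattice)
  \<comment> \<open>Since \<open>is_arg_min\<close> rules out strictly smaller values, the density
    of a minimizer is at most that of the integer lattice, which is the equality case.\<close>
  moreover have "similar_lattices integer_lattice L"
    if "is_arg_min packing_density well_rounded L" for L :: "(real ^ 'n) set"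
    using that well_rounded_packing_density(2)[of L] well_rounded_integer_lattice
    unfolding is_arg_min_def by (meson not_le)
  ultimately show ?thesis
    using W_star_not_extreme extreme_hexagonal_lattice extreme_2_imp_hexagonal
      hexagonal_lattice_in_W_star integer_lattice_in_W_star
    by blast
qed

end
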